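(* Let $d \geq 2$ be an integer and let $K$ be an infinite and perfect field with $\operatorname{char} K=0$ or $\operatorname{char} K>d$. Let $q \in S^d_\infty$ be an element of infinite strength. Then the $\mathrm{GL}_\infty$-orbit of $q$ is dense in $S^d_\infty$.
   Context: For each $e \ge 1$, $S^e_\infty:=\varprojlim_n S^e K^n$ is the inverse limit along the maps $S^e \pi: S^e K^n \to S^e K^{n-1}$ induced by the projections $\pi: K^n \to K^{n-1}$ forgetting the last coordinate. Each $S^d K^n$ carries the Zariski topology (closed sets are common zero sets of polynomial functions with coefficients in $K$), and $S^d_\infty$ carries the inverse limit topology. The group $\mathrm{GL}_\infty:=\bigcup_n \mathrm{GL}_n(K)$, where $\mathrm{GL}_n(K)$ is embedded in $\mathrm{GL}_{n+1}(K)$ via $g \mapsto \mathrm{diag}(g,1)$, acts on $S^d_\infty$: an element $g\in\mathrm{GL}_n(K)$ acts on $S^dK^m$ for all $m \ge n$ compatibly with the projections, hence on the inverse limit. Strength: multiplication of symmetric powers is compatible with the projections and yields products $S^e_\infty\times S^{d-e}_\infty\to S^d_\infty$. The strength of $q\in S^d_\infty$ is the minimal $k\in\mathbb{Z}_{\ge 0}$ such that $q=r_1 s_1 + \cdots + r_k s_k$ with $r_i \in S^{e_i}_\infty$, $s_i \in S^{d-e_i}_\infty$ for suitable $e_i \in \{1,\ldots,d-1\}$, and it is infinite if no such $k$ exists. *)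

theory Defs
  imports
    "HOL-Analysis.Analysis"
    "HOL-Computational_Algebra.Computational_Algebra"
    "HOL-Library.Poly_Mapping"
    "HOL-Library.Extended_Nat"
    "Jordan_Normal_Form.Matrix"
begin

definition perfect_field :: "'a::field itself \<Rightarrow> bool" where
  "perfect_field _ \<longleftrightarrow> CHAR('a) = 0 \<or> surj (\<lambda>x::'a. x ^ CHAR('a))"

text \<open>
  Polynomials in the variables \<open>x\<^sub>0, x\<^sub>1, \<dots>\<close>: finitely supported functions on exponent vectors,
  with the convolution product of \<^theory>\<open>HOL-Library.Poly_Mapping\<close>. The variable \<open>x\<^sub>i\<close> stands
  for the basis vector of \<open>K\<^sup>n\<close> with (zero-based) index \<open>i\<close>, so that \<open>S\<^sup>e K\<^sup>n\<close> is the space of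
  homogeneous polynomials of degree \<open>e\<close> in \<open>x\<^sub>0, \<dots>, x\<^sub>n\<^sub>-\<^sub>1\<close>.
\<close>

type_synonym 'a mpoly = "(nat \<Rightarrow>\<^sub>0 nat) \<Rightarrow>\<^sub>0 'a"

definition mon_degree :: "(nat \<Rightarrow>\<^sub>0 nat) \<Rightarrow> nat" where
  "mon_degree m = (\<Sum>i\<in>Poly_Mapping.keys m. Poly_Mapping.lookup m i)"

definition sym_pow :: "nat \<Rightarrow> nat \<Rightarrow> 'a::field mpoly set" where
  "sym_pow e n = {p. \<forall>m\<in>Poly_Mapping.keys p.
     mon_degree m = e \<and> Poly_Mapping.keys m \<subseteq> {..<n}}"

text \<open>
  The map \<open>S\<^sup>e A : S\<^sup>e K\<^sup>n \<rightarrow> S\<^sup>e K\<^sup>k\<close> induced by the linear map with \<open>k \<times> n\<close> matrix \<open>A\<close>: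
  substitute the linear form \<open>\<Sum>\<^sub>i A\<^sub>i\<^sub>j x\<^sub>i\<close> (the image of the \<open>j\<close>-th basis vector) for \<open>x\<^sub>j\<close>.
  It is meaningful only on polynomials in the variables with index below \<open>dim_col A\<close>.
\<close>

definition column_form :: "'a::field mat \<Rightarrow> nat \<Rightarrow> 'a mpoly" where
  "column_form A j =
     (\<Sum>i<dim_row A. Poly_Mapping.single (Poly_Mapping.single i 1) (A $$ (i, j)))"

definition sym_map :: "'a::field mat \<Rightarrow> 'a mpoly \<Rightarrow> 'a mpoly" where
  "sym_map A p =
     (\<Sum>m\<in>Poly_Mapping.keys p. Poly_Mapping.single 0 (Poly_Mapping.lookup p m) *
        (\<Prod>j\<in>Poly_Mapping.keys m. column_form A j ^ Poly_Mapping.lookup m j))"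

text \<open>The projection \<open>K\<^sup>N \<rightarrow> K\<^sup>n\<close> (for \<open>n \<le> N\<close>) forgetting the last \<open>N - n\<close> coordinates.\<close>

definition proj_mat :: "nat \<Rightarrow> nat \<Rightarrow> 'a::field mat" where
  "proj_mat N n = mat n N (\<lambda>(i, j). if i = j then 1 else 0)"

definition sym_inf :: "nat \<Rightarrow> (nat \<Rightarrow> 'a::field mpoly) set" where
  "sym_inf e =
     {q. \<forall>n. q n \<in> sym_pow e n \<and> sym_map (proj_mat (Suc n) n) (q (Suc n)) = q n}"


text \<open>
  Polynomial functions on spaces of polynomials, in terms of the coordinates given by the
  coefficients; on \<open>S\<^sup>e K\<^sup>n\<close> all but finitely many of these coordinates vanish identically.
\<close>

inductive_set poly_funs :: "('a::field mpoly \<Rightarrow> 'a) set" where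
  const: "(\<lambda>p. c) \<in> poly_funs"
| coord: "(\<lambda>p. Poly_Mapping.lookup p m) \<in> poly_funs"
| add: "f \<in> poly_funs \<Longrightarrow> g \<in> poly_funs \<Longrightarrow> (\<lambda>p. f p + g p) \<in> poly_funs"
| mult: "f \<in> poly_funs \<Longrightarrow> g \<in> poly_funs \<Longrightarrow> (\<lambda>p. f p * g p) \<in> poly_funs"

definition zero_locus :: "nat \<Rightarrow> nat \<Rightarrow> ('a::field mpoly \<Rightarrow> 'a) set \<Rightarrow> 'a mpoly set" where
  "zero_locus e n F = {p \<in> sym_pow e n. \<forall>f\<in>F. f p = 0}"

definition zariski :: "nat \<Rightarrow> nat \<Rightarrow> 'a::field mpoly topology" where
  "zariski e n = topology (\<lambda>U. \<exists>F\<subseteq>poly_funs. U = sym_pow e n - zero_locus e n F)"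

lemma istopology_zariski:
  "istopology (\<lambda>U. \<exists>F\<subseteq>poly_funs. U = sym_pow e n - zero_locus e n (F :: ('a::field mpoly \<Rightarrow> 'a) set))"
  (is "istopology ?T")
proof -
  have "?T (S \<inter> T)" if "?T S" "?T T" for S T
  proof -
    from that obtain F G where F: "F \<subseteq> poly_funs" "S = sym_pow e n - zero_locus e n F"
      and G: "G \<subseteq> poly_funs" "T = sym_pow e n - zero_locus e n G" by blast
    let ?H = "{(\<lambda>p. f p * g p) | f g. f \<in> F \<and> g \<in> G}"
    have "?H \<subseteq> poly_funs"
      using F(1) G(1) by (auto intro: poly_funs.mult)
    moreover have "S \<inter> T = sym_pow e n - zero_locus e n ?H"
    proof -
      have "(\<forall>h\<in>?H. h p = 0) \<longleftrightarrow> (\<forall>f\<in>F. f p = 0) \<or> (\<forall>g\<in>G. g p = 0)" for p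
        by fastforce
      then show ?thesis unfolding F(2) G(2) zero_locus_def by auto
    qed
    ultimately show ?thesis by blast
  qed
  moreover have "?T (\<Union>\<K>)" if "\<forall>U\<in>\<K>. ?T U" for \<K>
  proof -
    from that obtain F where F: "F U \<subseteq> poly_funs" "U = sym_pow e n - zero_locus e n (F U)"
      if "U \<in> \<K>" for U
      by metis
    have "p \<in> \<Union>\<K> \<longleftrightarrow> p \<in> sym_pow e n - zero_locus e n (\<Union>U\<in>\<K>. F U)" for p
    proof -
      have "p \<in> U \<longleftrightarrow> p \<in> sym_pow e n \<and> (\<exists>f\<in>F U. f p \<noteq> 0)" if "U \<in> \<K>" for U
        using F(2)[OF that] unfolding zero_locus_def by blast
      then show ?thesis unfolding zero_locus_def by blast
    qed
    then have "\<Union>\<K> = sym_pow e n - zero_locus e n (\<Union>U\<in>\<K>. F U)"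
      by blast
    then show ?thesis
      using F(1) by (intro exI[of _ "\<Union>U\<in>\<K>. F U"]) auto
  qed
  ultimately show ?thesis unfolding istopology_def by blast
qed

lemma openin_zariski:
  "openin (zariski e n) U \<longleftrightarrow> (\<exists>F\<subseteq>poly_funs. U = sym_pow e n - zero_locus e n F)"
  unfolding zariski_def by (simp add: topology_inverse'[OF istopology_zariski])

lemma topspace_zariski [simp]: "topspace (zariski e n) = sym_pow e n"
proof
  show "topspace (zariski e n) \<subseteq> sym_pow e n"
    unfolding topspace_def openin_zariski by blast
  have "openin (zariski e n) (sym_pow e n)"
    unfolding openin_zariski
    by (rule exI[of _ "{\<lambda>p. 1}"]) (auto simp: zero_locus_def poly_funs.const)
  then show "sym_pow e n \<subseteq> topspace (zariski e n)"
    by (rule openin_subset)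
qed

lemma closedin_zariski:
  "closedin (zariski e n) C \<longleftrightarrow> (\<exists>F\<subseteq>poly_funs. C = zero_locus e n F)"
proof -
  have sub: "zero_locus e n F \<subseteq> sym_pow e n" for F :: "('a mpoly \<Rightarrow> 'a) set"
    unfolding zero_locus_def by blast
  show ?thesis
    unfolding closedin_def topspace_zariski openin_zariski
    using sub by (metis double_diff order_refl)
qed

definition sym_inf_topology :: "nat \<Rightarrow> (nat \<Rightarrow> 'a::field mpoly) topology" where
  "sym_inf_topology e = subtopology (product_topology (zariski e) UNIV) (sym_inf e)"

lemma topspace_sym_inf_topology [simp]: "topspace (sym_inf_topology e) = sym_inf e"
  unfolding sym_inf_topology_def by (auto simp: sym_inf_def)


definition GL :: "nat \<Rightarrow> 'a::field mat set" where
  "GL n = {g \<in> carrier_mat n n. invertible_mat g}"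

definition diag_embed :: "nat \<Rightarrow> 'a::field mat \<Rightarrow> 'a mat" where
  "diag_embed N g =
     (let n = dim_row g
      in four_block_mat g (0\<^sub>m n (N - n)) (0\<^sub>m (N - n) n) (1\<^sub>m (N - n)))"

text \<open>
  An element of the union of the groups \<open>GL\<^sub>n(K)\<close> is represented by any of the matrices
  \<open>diag(g, 1, \<dots>, 1)\<close>. The action of an \<open>n \<times> n\<close> matrix is the natural one in the components
  \<open>m \<ge> n\<close>; the components \<open>m < n\<close> are then determined by projecting the \<open>n\<close>-th one.
\<close>

definition gl_act :: "'a::field mat \<Rightarrow> (nat \<Rightarrow> 'a mpoly) \<Rightarrow> (nat \<Rightarrow> 'a mpoly)" where
  "gl_act g q =
     (\<lambda>m. let N = max m (dim_row g)
          in sym_map (proj_mat N m) (sym_map (diag_embed N g) (q N)))"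

definition gl_orbit :: "(nat \<Rightarrow> 'a::field mpoly) \<Rightarrow> (nat \<Rightarrow> 'a mpoly) set" where
  "gl_orbit q = {gl_act g q | g. g \<in> (\<Union>n. GL n)}"


definition has_strength_decomp :: "nat \<Rightarrow> (nat \<Rightarrow> 'a::field mpoly) \<Rightarrow> nat \<Rightarrow> bool" where
  "has_strength_decomp d q k \<longleftrightarrow>
     (\<exists>e r s. (\<forall>i<k. e i \<in> {1..d - 1} \<and> r i \<in> sym_inf (e i) \<and> s i \<in> sym_inf (d - e i)) \<and>
              (\<forall>n. q n = (\<Sum>i<k. r i n * s i n)))"

text \<open>The infimum of the empty set of extended naturals is \<open>\<infinity>\<close>.\<close>

definition strength :: "nat \<Rightarrow> (nat \<Rightarrow> 'a::field mpoly) \<Rightarrow> enat" where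
  "strength d q = Inf (enat ` {k. has_strength_decomp d q k})"

end

theory Submission
  imports Defs
begin

text \<open>
  View \<open>q\<close> as a homogeneous function of degree \<open>d\<close> on the finitely supported vectors. If its orbit is
  not dense, then some polynomial \<open>f \<noteq> 0\<close> on \<open>S\<^sup>d K\<^sup>n\<close> vanishes at all \<open>A \<cdot> q\<close>, where \<open>A\<close> is any matrix
  with \<open>n\<close> rows: the matrices \<open>[A | s I]\<close> with \<open>s \<noteq> 0\<close> extend to invertible ones, and one specialises
  to \<open>s = 0\<close>. Take \<open>f\<close> of minimal degree. As \<open>K\<close> is perfect, some partial derivative of \<open>f\<close> is nonzero
  at some \<open>A \<cdot> q\<close>, and as the \<open>d\<close>-th powers of linear forms span \<open>S\<^sup>d K\<^sup>n\<close>, the derivative in the direction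
  of some \<open>(\<Sum>\<^sub>i \<tau>\<^sub>i x\<^sub>i)\<^sup>d\<close> is nonzero. The coordinates of \<open>(A + s \<tau> w\<^sup>T) \<cdot> q\<close> are polynomials in \<open>s\<close> whose
  \<open>k\<close>-th coefficient is homogeneous of degree \<open>k\<close> in \<open>w\<close>, the \<open>d\<close>-th one being a multiple of \<open>q(w)\<close>. Hence the
  coefficient of \<open>s\<^sup>d\<close> in \<open>f((A + s \<tau> w\<^sup>T) \<cdot> q) = 0\<close> is a nonzero multiple of \<open>q(w)\<close> plus products of forms
  of lower degree, so \<open>q\<close> has finite strength.
\<close>

section \<open>Coefficients as combinations of evaluations\<close>

text \<open>Lagrange interpolation: \<open>b t\<close> is the \<open>k\<close>-th coefficient of the
  basis polynomial \<open>L t\<close> at the node \<open>t\<close>. For \<open>j \<le> D\<close>,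
  interpolating the values \<open>t ^ j\<close> returns the monomial itself, and its
  \<open>k\<close>-th coefficient is read off.\<close>

lemma univariate_coeff_functional:
  assumes inf: "infinite (UNIV :: 'a set)"
  obtains U and b :: "'a::field \<Rightarrow> 'a" where "finite U"
    "\<And>j. j \<le> D \<Longrightarrow> (\<Sum>t\<in>U. b t * t ^ j) = (if j = k then 1 else 0)"
proof -
  obtain U :: "'a set" where U: "finite U" "card U = Suc D"
    using infinite_arbitrarily_large[OF inf] by blast
  define L where "L t = (\<Prod>u\<in>U - {t}. Polynomial.smult (1 / (t - u)) [:- u, 1:])" for t :: 'a
  have deg: "degree (L t) \<le> D" if "t \<in> U" for t
  proof -
    have "degree (L t) \<le> (\<Sum>u\<in>U - {t}. degree (Polynomial.smult (1 / (t - u)) [:- u, 1:]))"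
      unfolding L_def using U(1) by (intro degree_prod_sum_le[simplified o_def]) auto
    also have "\<dots> \<le> (\<Sum>u\<in>U - {t}. 1)"
      by (intro sum_mono order.trans[OF degree_smult_le]) simp
    also have "\<dots> = D" using U that by simp
    finally show ?thesis .
  qed
  have val: "poly (L t) v = (if v = t then 1 else 0)" if "t \<in> U" "v \<in> U" for t v
  proof (cases "v = t")
    case True
    then show ?thesis by (auto simp: L_def poly_prod diff_divide_distrib[symmetric] split: if_splits intro!: prod.neutral)
  next
    case False
    then have "v \<in> U - {t}" using that by simp
    then show ?thesis using False U(1)
      by (auto simp: L_def poly_prod prod_zero_iff intro!: bexI[of _ v])
  qed
  have "(\<Sum>t\<in>U. coeff (L t) k * t ^ j) = (if j = k then 1 else 0)" if j: "j \<le> D" for j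
  proof -
    \<comment> \<open>Both sides have degree at most \<open>D\<close> and agree at the
      \<open>D + 1\<close> nodes.\<close>
    have "(\<Sum>t\<in>U. Polynomial.smult (t ^ j) (L t)) = monom 1 j"
    proof (rule poly_eqI_degree[where A = U])
      fix v assume v: "v \<in> U"
      have "poly (\<Sum>t\<in>U. Polynomial.smult (t ^ j) (L t)) v = (\<Sum>t\<in>U. if v = t then t ^ j else 0)"
        unfolding poly_sum by (intro sum.cong) (auto simp: val v)
      then show "poly (\<Sum>t\<in>U. Polynomial.smult (t ^ j) (L t)) v = poly (monom 1 j) v"
        using U(1) v by (simp add: poly_monom)
    next
      have "degree (\<Sum>t\<in>U. Polynomial.smult (t ^ j) (L t)) \<le> D"
        using U(1) deg by (intro degree_sum_le) (auto intro: order.trans[OF degree_smult_le])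
      then show "card U > degree (\<Sum>t\<in>U. Polynomial.smult (t ^ j) (L t))" using U(2) by simp
      show "card U > degree (monom (1::'a) j)" using U(2) j by (simp add: degree_monom_eq)
    qed
    then have "coeff (\<Sum>t\<in>U. Polynomial.smult (t ^ j) (L t)) k = coeff (monom 1 j) k" by simp
    then show ?thesis by (simp add: coeff_sum mult.commute)
  qed
  then show ?thesis by (intro that[OF U(1), of "\<lambda>t. coeff (L t) k"]) simp
qed

text \<open>Tensor product of the univariate functionals for the exponents
  \<open>\<alpha> i\<close>: a sum over the grid of nodes factors into one sum per
  coordinate.\<close>

lemma multivariate_coeff_functional:
    assumes inf: "infinite (UNIV :: 'a set)" and I: "finite I"
  obtains U and b :: "('i \<Rightarrow> 'a::field) \<Rightarrow> 'a" where "finite U"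
    "\<And>m. (\<And>i. i \<in> I \<Longrightarrow> m i \<le> D) \<Longrightarrow>
      (\<Sum>u\<in>U. b u * (\<Prod>i\<in>I. u i ^ m i)) = (if \<forall>i\<in>I. m i = \<alpha> i then 1 else 0)"
proof -
  have "\<exists>U b. finite U \<and> (\<forall>j\<le>D. (\<Sum>t\<in>U. b t * t ^ j) = (if j = k then 1 else (0::'a)))" for k
    using univariate_coeff_functional[OF inf, of D k] by metis
  then obtain U b where U: "\<And>k. finite (U k)"
    and b: "\<And>k j. j \<le> D \<Longrightarrow> (\<Sum>t\<in>U k. b k t * t ^ j) = (if j = k then 1 else (0::'a))"
    by metis
  define V where "V = PiE I (\<lambda>i. U (\<alpha> i))"
  have "(\<Sum>u\<in>V. (\<Prod>i\<in>I. b (\<alpha> i) (u i)) * (\<Prod>i\<in>I. u i ^ m i)) =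
      (if \<forall>i\<in>I. m i = \<alpha> i then 1 else 0)" if m: "\<And>i. i \<in> I \<Longrightarrow> m i \<le> D" for m
  proof -
    have "(\<Sum>u\<in>V. (\<Prod>i\<in>I. b (\<alpha> i) (u i)) * (\<Prod>i\<in>I. u i ^ m i)) =
        (\<Sum>u\<in>V. \<Prod>i\<in>I. b (\<alpha> i) (u i) * u i ^ m i)"
      by (simp add: prod.distrib)
    also have "\<dots> = (\<Prod>i\<in>I. \<Sum>t\<in>U (\<alpha> i). b (\<alpha> i) t * t ^ m i)"
      unfolding V_def using I U by (subst prod_sum_PiE) auto
    also have "\<dots> = (\<Prod>i\<in>I. if m i = \<alpha> i then 1 else 0)"
      using m by (intro prod.cong) (auto simp: b)
    also have "\<dots> = (if \<forall>i\<in>I. m i = \<alpha> i then 1 else 0)"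
      using I by (auto intro: prod.neutral)
    finally show ?thesis .
  qed
  moreover have "finite V" unfolding V_def using I U by (intro finite_PiE) auto
  ultimately show ?thesis
    using that[of V "\<lambda>u. \<Prod>i\<in>I. b (\<alpha> i) (u i)"] by auto
qed

section \<open>Evaluation of polynomials at points, and degrees of monomials\<close>

definition mon_eval :: "('i \<Rightarrow> 'a) \<Rightarrow> ('i \<Rightarrow>\<^sub>0 nat) \<Rightarrow> 'a::comm_semiring_1" where
  "mon_eval w m = (\<Prod>j\<in>Poly_Mapping.keys m. w j ^ Poly_Mapping.lookup m j)"

definition mpoly_eval :: "(nat \<Rightarrow> 'a) \<Rightarrow> 'a::field mpoly \<Rightarrow> 'a" where
  "mpoly_eval w p = (\<Sum>m\<in>Poly_Mapping.keys p. Poly_Mapping.lookup p m * mon_eval w m)"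

lemma mon_eval_superset:
  assumes "finite I" "Poly_Mapping.keys m \<subseteq> I"
  shows "mon_eval w m = (\<Prod>j\<in>I. w j ^ Poly_Mapping.lookup m j)"
  unfolding mon_eval_def
  by (rule prod.mono_neutral_left) (use assms in \<open>auto simp: in_keys_iff\<close>)

lemma mon_eval_0 [simp]: "mon_eval w 0 = 1"
  by (simp add: mon_eval_def)

lemma mon_eval_single [simp]: "mon_eval w (Poly_Mapping.single i k) = w i ^ k"
  by (subst mon_eval_superset[of "{i}"]) auto

lemma mon_eval_add: "mon_eval w (m + m') = mon_eval w m * mon_eval w m'"
proof -
  let ?I = "Poly_Mapping.keys m \<union> Poly_Mapping.keys m'"
  have "Poly_Mapping.keys (m + m') \<subseteq> ?I" by (rule Poly_Mapping.keys_add)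
  then show ?thesis
    by (simp add: mon_eval_superset[of ?I] lookup_add power_add prod.distrib)
qed

lemma mpoly_eval_superset:
  assumes "finite M" "Poly_Mapping.keys p \<subseteq> M"
  shows "mpoly_eval w p = (\<Sum>m\<in>M. Poly_Mapping.lookup p m * mon_eval w m)"
  unfolding mpoly_eval_def
  by (rule sum.mono_neutral_left) (use assms in \<open>auto simp: in_keys_iff\<close>)

lemma mpoly_eval_0 [simp]: "mpoly_eval w 0 = 0"
  by (simp add: mpoly_eval_def)

lemma mpoly_eval_single [simp]: "mpoly_eval w (Poly_Mapping.single m c) = c * mon_eval w m"
  by (subst mpoly_eval_superset[of "{m}"]) auto

lemma mpoly_eval_1 [simp]: "mpoly_eval w 1 = 1"
  using mpoly_eval_single[of w 0 1] by simp

lemma mpoly_eval_add [simp]: "mpoly_eval w (p + q) = mpoly_eval w p + mpoly_eval w q"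
proof -
  let ?M = "Poly_Mapping.keys p \<union> Poly_Mapping.keys q"
  have "Poly_Mapping.keys (p + q) \<subseteq> ?M" by (rule Poly_Mapping.keys_add)
  then show ?thesis
    by (simp add: mpoly_eval_superset[of ?M] lookup_add distrib_right sum.distrib)
qed

lemma mpoly_eval_sum [simp]: "mpoly_eval w (sum p I) = (\<Sum>i\<in>I. mpoly_eval w (p i))"
  by (induction I rule: infinite_finite_induct) auto

lemma mpoly_eq_sum_single:
  "p = (\<Sum>m\<in>Poly_Mapping.keys p. Poly_Mapping.single m (Poly_Mapping.lookup p m))"
proof (rule poly_mapping_eqI)
  fix k
  show "Poly_Mapping.lookup p k = Poly_Mapping.lookup
      (\<Sum>m\<in>Poly_Mapping.keys p. Poly_Mapping.single m (Poly_Mapping.lookup p m)) k"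
    by (cases "k \<in> Poly_Mapping.keys p")
      (auto simp: lookup_sum lookup_single when_def in_keys_iff)
qed

lemma mpoly_eval_mult [simp]: "mpoly_eval w (p * q) = mpoly_eval w p * mpoly_eval w q"
proof -
  have "mpoly_eval w (p * q) = mpoly_eval w
      ((\<Sum>m\<in>Poly_Mapping.keys p. Poly_Mapping.single m (Poly_Mapping.lookup p m)) *
       (\<Sum>m\<in>Poly_Mapping.keys q. Poly_Mapping.single m (Poly_Mapping.lookup q m)))"
    by (simp only: mpoly_eq_sum_single[symmetric])
  also have "\<dots> = (\<Sum>m\<in>Poly_Mapping.keys p. Poly_Mapping.lookup p m * mon_eval w m) *
      (\<Sum>m\<in>Poly_Mapping.keys q. Poly_Mapping.lookup q m * mon_eval w m)"
    by (simp add: sum_product mult_single mon_eval_add mult_ac)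
  also have "\<dots> = mpoly_eval w p * mpoly_eval w q"
    by (simp only: mpoly_eval_def)
  finally show ?thesis .
qed

lemma mpoly_eval_prod [simp]: "mpoly_eval w (prod p I) = (\<Prod>i\<in>I. mpoly_eval w (p i))"
  by (induction I rule: infinite_finite_induct) auto

lemma mpoly_eval_power [simp]: "mpoly_eval w (p ^ k) = mpoly_eval w p ^ k"
  by (induction k) auto

lemma mpoly_eval_uminus [simp]: "mpoly_eval w (- p) = - mpoly_eval w p"
  using mpoly_eval_add[of w p "- p"] by (simp del: mpoly_eval_add add: eq_neg_iff_add_eq_0 add.commute)

lemma mpoly_eval_diff [simp]: "mpoly_eval w (p - q) = mpoly_eval w p - mpoly_eval w q"
  using mpoly_eval_add[of w p "- q"] by simp

lemma mon_degree_superset: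
  assumes "finite I" "Poly_Mapping.keys m \<subseteq> I"
  shows "mon_degree m = (\<Sum>j\<in>I. Poly_Mapping.lookup m j)"
  unfolding mon_degree_def
  by (rule sum.mono_neutral_left) (use assms in \<open>auto simp: in_keys_iff\<close>)

lemma mon_degree_0 [simp]: "mon_degree 0 = 0"
  by (simp add: mon_degree_def)

lemma mon_degree_single [simp]: "mon_degree (Poly_Mapping.single i k) = k"
  by (subst mon_degree_superset[of "{i}"]) auto

lemma mon_degree_add: "mon_degree (m + m') = mon_degree m + mon_degree m'"
proof -
  let ?I = "Poly_Mapping.keys m \<union> Poly_Mapping.keys m'"
  have "Poly_Mapping.keys (m + m') \<subseteq> ?I" by (rule Poly_Mapping.keys_add)
  then show ?thesis
    by (simp add: mon_degree_superset[of ?I] lookup_add sum.distrib)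
qed

lemma lookup_le_mon_degree: "Poly_Mapping.lookup m i \<le> mon_degree m"
  by (cases "i \<in> Poly_Mapping.keys m") (auto simp: mon_degree_def in_keys_iff intro: member_le_sum)

lemma mon_degree_eq_0_iff: "mon_degree m = 0 \<longleftrightarrow> m = 0"
  by (metis le_zero_eq lookup_le_mon_degree lookup_zero mon_degree_0 poly_mapping_eqI)

text \<open>One combination of evaluations serves all polynomials of degree at most \<open>D\<close>
  in the variables \<open>I\<close>. Questions about coordinates thereby become questions about
  values.\<close>

lemma coeff_functional:
  assumes inf: "infinite (UNIV :: 'a set)" and I: "finite I"
  shows "\<exists>U b. \<forall>p. (\<forall>m\<in>Poly_Mapping.keys p. mon_degree m \<le> D \<and> Poly_Mapping.keys m \<subseteq> I) \<longrightarrow>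
      Poly_Mapping.lookup p \<alpha> = (\<Sum>u\<in>U. b u * mpoly_eval u (p :: 'a::field mpoly))"
proof (cases "Poly_Mapping.keys \<alpha> \<subseteq> I")
  case False
  \<comment> \<open>A monomial with a variable outside \<open>I\<close> never occurs, so the empty
    combination works.\<close>
  have "Poly_Mapping.lookup p \<alpha> = 0"
    if "\<forall>m\<in>Poly_Mapping.keys p. mon_degree m \<le> D \<and> Poly_Mapping.keys m \<subseteq> I" for p :: "'a mpoly"
    using that False by (auto simp: in_keys_iff)
  then show ?thesis by (intro exI[of _ "{}"]) auto
next
  case True
  obtain U and b :: "(nat \<Rightarrow> 'a) \<Rightarrow> 'a" where b:
    "\<And>m. (\<And>i. i \<in> I \<Longrightarrow> m i \<le> D) \<Longrightarrow> (\<Sum>u\<in>U. b u * (\<Prod>i\<in>I. u i ^ m i)) =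
      (if \<forall>i\<in>I. m i = Poly_Mapping.lookup \<alpha> i then 1 else 0)"
    using multivariate_coeff_functional[OF inf I, of D "Poly_Mapping.lookup \<alpha>"] by blast
  show ?thesis
  proof (intro exI[of _ U] exI[of _ b] allI impI)
    fix p :: "'a mpoly"
    assume p: "\<forall>m\<in>Poly_Mapping.keys p. mon_degree m \<le> D \<and> Poly_Mapping.keys m \<subseteq> I"
    have eq: "(\<Sum>u\<in>U. b u * mon_eval u m) = (if m = \<alpha> then 1 else 0)" if m: "m \<in> Poly_Mapping.keys p" for m
    proof -
      have "(\<forall>i\<in>I. Poly_Mapping.lookup m i = Poly_Mapping.lookup \<alpha> i) \<longleftrightarrow> m = \<alpha>"
        using bspec[OF p m] True by (metis in_keys_iff poly_mapping_eqI subsetD)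
      moreover have "Poly_Mapping.lookup m i \<le> D" for i
        using bspec[OF p m] lookup_le_mon_degree[of m i] by auto
      ultimately show ?thesis
        using b[of "Poly_Mapping.lookup m"] bspec[OF p m] I by (simp add: mon_eval_superset)
    qed
    have "(\<Sum>u\<in>U. b u * mpoly_eval u p) =
        (\<Sum>m\<in>Poly_Mapping.keys p. Poly_Mapping.lookup p m * (\<Sum>u\<in>U. b u * mon_eval u m))"
      unfolding mpoly_eval_def sum_distrib_left by (subst sum.swap) (simp add: mult_ac)
    also have "\<dots> = (\<Sum>m\<in>Poly_Mapping.keys p. if m = \<alpha> then Poly_Mapping.lookup p m else 0)"
      by (intro sum.cong) (auto simp: eq)
    also have "\<dots> = Poly_Mapping.lookup p \<alpha>" by (auto simp: in_keys_iff)
    finally show "Poly_Mapping.lookup p \<alpha> = (\<Sum>u\<in>U. b u * mpoly_eval u p)" by simp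
  qed
qed

text \<open>Each coefficient of the difference is a combination of its values, which all vanish.
  Most later identities of polynomials are checked pointwise through this equivalence.\<close>

lemma mpoly_eq_iff_eval:
  fixes p q :: "'a::field mpoly"
  assumes inf: "infinite (UNIV :: 'a set)"
  shows "p = q \<longleftrightarrow> (\<forall>w. mpoly_eval w p = mpoly_eval w q)"
proof
  assume eq: "\<forall>w. mpoly_eval w p = mpoly_eval w q"
  show "p = q"
  proof (rule poly_mapping_eqI)
    fix \<alpha>
    let ?M = "Poly_Mapping.keys (p - q)"
    have fin: "finite (\<Union>m\<in>?M. Poly_Mapping.keys m)" by simp
    obtain U and b :: "(nat \<Rightarrow> 'a) \<Rightarrow> 'a" where b:
      "\<forall>r. (\<forall>m\<in>Poly_Mapping.keys r. mon_degree m \<le> Max (mon_degree ` ?M) \<and>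
          Poly_Mapping.keys m \<subseteq> (\<Union>m\<in>?M. Poly_Mapping.keys m)) \<longrightarrow>
        Poly_Mapping.lookup r \<alpha> = (\<Sum>u\<in>U. b u * mpoly_eval u r)"
      using coeff_functional[OF inf fin, of "Max (mon_degree ` ?M)" \<alpha>] by (elim exE) (rule that)
    have "Poly_Mapping.lookup (p - q) \<alpha> = (\<Sum>u\<in>U. b u * mpoly_eval u (p - q))"
      by (rule b[rule_format]) auto
    then show "Poly_Mapping.lookup p \<alpha> = Poly_Mapping.lookup q \<alpha>"
      using eq by (simp add: lookup_minus)
  qed
qed auto

section \<open>Homogeneous polynomials, their limits and finite strength\<close>

lemma mpoly_eval_cong:
  assumes "p \<in> sym_pow e n" "\<And>j. j < n \<Longrightarrow> w j = w' j"
  shows "mpoly_eval w p = mpoly_eval w' p"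
  unfolding mpoly_eval_def mon_eval_def
  by (intro sum.cong arg_cong2[where f = "(*)"] prod.cong refl)
    (use assms in \<open>fastforce simp: sym_pow_def\<close>)

lemma mpoly_eval_scale:
  assumes "p \<in> sym_pow e n"
  shows "mpoly_eval (\<lambda>j. s * w j) p = s ^ e * mpoly_eval w p"
proof -
  have "mon_eval (\<lambda>j. s * w j) m = s ^ mon_degree m * mon_eval w m" for m
    by (simp add: mon_eval_def mon_degree_def power_mult_distrib prod.distrib power_sum)
  then show ?thesis using assms
    by (auto simp: mpoly_eval_def sum_distrib_left sym_pow_def mult_ac intro!: sum.cong)
qed

lemma sym_pow_0 [simp]: "0 \<in> sym_pow e n"
  by (simp add: sym_pow_def)

lemma sym_pow_add: "p \<in> sym_pow e n \<Longrightarrow> q \<in> sym_pow e n \<Longrightarrow> p + q \<in> sym_pow e n"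
  using Poly_Mapping.keys_add[of p q] unfolding sym_pow_def by blast

lemma sym_pow_sum: "(\<And>i. i \<in> I \<Longrightarrow> p i \<in> sym_pow e n) \<Longrightarrow> sum p I \<in> sym_pow e n"
  by (induction I rule: infinite_finite_induct) (auto intro: sym_pow_add)

lemma sym_pow_single:
  "mon_degree m = e \<Longrightarrow> Poly_Mapping.keys m \<subseteq> {..<n} \<Longrightarrow> Poly_Mapping.single m c \<in> sym_pow e n"
  by (auto simp: sym_pow_def)

lemma sym_pow_mult:
  assumes "p \<in> sym_pow e n" "q \<in> sym_pow e' n"
  shows "p * q \<in> sym_pow (e + e') n"
  unfolding sym_pow_def
proof (intro CollectI ballI)
  fix m assume "m \<in> Poly_Mapping.keys (p * q)"
  then obtain a b where "m = a + b" "a \<in> Poly_Mapping.keys p" "b \<in> Poly_Mapping.keys q"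
    using keys_mult[of p q] by blast
  then show "mon_degree m = e + e' \<and> Poly_Mapping.keys m \<subseteq> {..<n}"
    using assms Poly_Mapping.keys_add[of a b] by (fastforce simp: sym_pow_def mon_degree_add)
qed

lemma sym_pow_scale: "p \<in> sym_pow e n \<Longrightarrow> Poly_Mapping.single 0 c * p \<in> sym_pow e n"
  using sym_pow_mult[OF sym_pow_single[of 0 0 n c]] by simp

lemma sym_pow_1 [simp]: "1 \<in> sym_pow 0 n"
  by (simp add: sym_pow_def)

lemma sym_pow_power: "p \<in> sym_pow e n \<Longrightarrow> p ^ k \<in> sym_pow (k * e) n"
  by (induction k) (auto dest: sym_pow_mult)

lemma sym_pow_prod:
  "(\<And>i. i \<in> I \<Longrightarrow> p i \<in> sym_pow (e i) n) \<Longrightarrow> prod p I \<in> sym_pow (sum e I) n"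
  by (induction I rule: infinite_finite_induct) (auto intro: sym_pow_mult)

lemma sym_pow_coeff_functional:
  assumes inf: "infinite (UNIV :: 'a::field set)"
  shows "\<exists>U b. \<forall>p\<in>sym_pow e n. Poly_Mapping.lookup p \<alpha> = (\<Sum>u\<in>U. b u * mpoly_eval u (p :: 'a mpoly))"
proof -
  obtain U and b :: "(nat \<Rightarrow> 'a) \<Rightarrow> 'a" where b:
    "\<forall>p. (\<forall>m\<in>Poly_Mapping.keys p. mon_degree m \<le> e \<and> Poly_Mapping.keys m \<subseteq> {..<n}) \<longrightarrow>
      Poly_Mapping.lookup p \<alpha> = (\<Sum>u\<in>U. b u * mpoly_eval u p)"
    using coeff_functional[OF inf finite_lessThan, of e n \<alpha>] by (elim exE) (rule that)
  show ?thesis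
    by (intro exI[of _ U] exI[of _ b] ballI b[rule_format]) (auto simp: sym_pow_def)
qed

section \<open>Linear substitutions, projections and the inverse limit in terms of values\<close>

lemma column_form_in_sym_pow: "column_form A j \<in> sym_pow 1 (dim_row A)"
  unfolding column_form_def by (intro sym_pow_sum sym_pow_single) auto

lemma sym_map_in_sym_pow:
  assumes "p \<in> sym_pow e n"
  shows "sym_map A p \<in> sym_pow e (dim_row A)"
  unfolding sym_map_def
proof (intro sym_pow_sum sym_pow_scale)
  fix m assume "m \<in> Poly_Mapping.keys p"
  then have "e = (\<Sum>j\<in>Poly_Mapping.keys m. Poly_Mapping.lookup m j * 1)"
    using assms by (auto simp: sym_pow_def mon_degree_def)
  then show "(\<Prod>j\<in>Poly_Mapping.keys m. column_form A j ^ Poly_Mapping.lookup m j) \<in> sym_pow e (dim_row A)"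
    by (simp only:) (intro sym_pow_prod sym_pow_power column_form_in_sym_pow)
qed

lemma mpoly_eval_column_form: "mpoly_eval w (column_form A j) = (\<Sum>i<dim_row A. w i * A $$ (i, j))"
  by (simp add: column_form_def mult.commute)

text \<open>On functions a matrix acts through its transpose: the new value at \<open>w\<close> is
  the old value at the row vector \<open>w A\<close>.\<close>

lemma mpoly_eval_sym_map:
  "mpoly_eval w (sym_map A p) = mpoly_eval (\<lambda>j. \<Sum>i<dim_row A. w i * A $$ (i, j)) p"
  by (simp add: sym_map_def mpoly_eval_column_form) (simp add: mpoly_eval_def mon_eval_def)

text \<open>The vector of the first \<open>n\<close> coordinates, padded by zeros. This padding is
  the transpose of the projection \<open>proj_mat\<close>.\<close>

definition trunc :: "nat \<Rightarrow> (nat \<Rightarrow> 'a::zero) \<Rightarrow> nat \<Rightarrow> 'a" where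
  "trunc n w j = (if j < n then w j else 0)"

lemma mpoly_eval_proj:
  assumes "p \<in> sym_pow e m"
  shows "mpoly_eval w (sym_map (proj_mat m n) p) = mpoly_eval (trunc n w) p"
  unfolding mpoly_eval_sym_map
proof (rule mpoly_eval_cong[OF assms])
  fix j assume "j < m"
  then have "(\<Sum>i<dim_row (proj_mat m n). w i * proj_mat m n $$ (i, j)) = (\<Sum>i<n. if i = j then w i else 0)"
    by (intro sum.cong) (auto simp: proj_mat_def)
  then show "(\<Sum>i<dim_row (proj_mat m n). w i * proj_mat m n $$ (i, j)) = trunc n w j"
    by (simp add: trunc_def)
qed

lemma sym_infD: "q \<in> sym_inf e \<Longrightarrow> q n \<in> sym_pow e n"
  by (simp add: sym_inf_def)

text \<open>Projecting a form is dual to padding a vector by zeros, so a compatible sequence amounts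
  to one function on finitely supported vectors.\<close>

lemma sym_inf_iff:
  fixes q :: "nat \<Rightarrow> 'a::field mpoly"
  assumes inf: "infinite (UNIV :: 'a set)"
  shows "q \<in> sym_inf e \<longleftrightarrow> (\<forall>n. q n \<in> sym_pow e n) \<and>
    (\<forall>n w. mpoly_eval (trunc n w) (q (Suc n)) = mpoly_eval w (q n))"
proof -
  have "sym_map (proj_mat (Suc n) n) (q (Suc n)) = q n \<longleftrightarrow>
      (\<forall>w. mpoly_eval (trunc n w) (q (Suc n)) = mpoly_eval w (q n))" if "q (Suc n) \<in> sym_pow e (Suc n)" for n
    by (simp add: mpoly_eq_iff_eval[OF inf] mpoly_eval_proj[OF that])
  then show ?thesis unfolding sym_inf_def by blast
qed

lemma trunc_trunc [simp]: "trunc m (trunc n w) = trunc (min m n) w"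
  by (auto simp: trunc_def)

lemma mpoly_eval_trunc: "p \<in> sym_pow e n \<Longrightarrow> mpoly_eval (trunc n w) p = mpoly_eval w p"
  by (rule mpoly_eval_cong) (auto simp: trunc_def)

lemma mpoly_eval_sym_inf:
  fixes q :: "nat \<Rightarrow> 'a::field mpoly"
  assumes inf: "infinite (UNIV :: 'a set)" and q: "q \<in> sym_inf e" and "n \<le> m"
  shows "mpoly_eval (trunc n w) (q m) = mpoly_eval w (q n)"
  using \<open>n \<le> m\<close>
proof (induction m rule: dec_induct)
  case base
  then show ?case using q mpoly_eval_trunc sym_infD by blast
next
  case (step m)
  have "mpoly_eval (trunc n w) (q (Suc m)) = mpoly_eval (trunc m (trunc n w)) (q (Suc m))"
    using step by (simp add: min_def)
  also have "\<dots> = mpoly_eval (trunc n w) (q m)"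
    using q unfolding sym_inf_iff[OF inf] by blast
  finally show ?case using step by simp
qed

lemma sym_inf_add:
  fixes p q :: "nat \<Rightarrow> 'a::field mpoly"
  assumes inf: "infinite (UNIV :: 'a set)" and "p \<in> sym_inf e" "q \<in> sym_inf e"
  shows "(\<lambda>n. p n + q n) \<in> sym_inf e"
  using assms by (auto simp: sym_inf_iff sym_pow_add)

lemma sym_inf_0: "(\<lambda>n. 0 :: 'a::field mpoly) \<in> sym_inf e"
  by (simp add: sym_inf_def sym_map_def)

lemma sym_inf_sum:
  fixes p :: "'i \<Rightarrow> nat \<Rightarrow> 'a::field mpoly"
  assumes inf: "infinite (UNIV :: 'a set)" and "\<And>i. i \<in> I \<Longrightarrow> p i \<in> sym_inf e"
  shows "(\<lambda>n. \<Sum>i\<in>I. p i n) \<in> sym_inf e"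
  using assms(2)
  by (induction I rule: infinite_finite_induct) (auto intro!: sym_inf_add[OF inf] sym_inf_0)

lemma sym_inf_mult:
  fixes p q :: "nat \<Rightarrow> 'a::field mpoly"
  assumes inf: "infinite (UNIV :: 'a set)" and "p \<in> sym_inf e" "q \<in> sym_inf e'"
  shows "(\<lambda>n. p n * q n) \<in> sym_inf (e + e')"
  using assms by (auto simp: sym_inf_iff sym_pow_mult)

lemma sym_inf_const: "(\<lambda>n. Poly_Mapping.single 0 c) \<in> sym_inf 0"
  by (auto simp: sym_inf_def sym_map_def sym_pow_single)

lemma sym_inf_scale:
  fixes p :: "nat \<Rightarrow> 'a::field mpoly"
  assumes inf: "infinite (UNIV :: 'a set)" and "p \<in> sym_inf e"
  shows "(\<lambda>n. Poly_Mapping.single 0 c * p n) \<in> sym_inf e"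
  using sym_inf_mult[OF inf sym_inf_const assms(2), of c] by simp

section \<open>Elements of finite strength\<close>

definition finite_strength :: "nat \<Rightarrow> (nat \<Rightarrow> 'a::field mpoly) \<Rightarrow> bool" where
  "finite_strength d h \<longleftrightarrow> (\<exists>k. has_strength_decomp d h k)"

lemma finite_strengthE:
  assumes "finite_strength d h"
  obtains k :: nat and e r s where
    "\<And>i. i < k \<Longrightarrow> e i \<in> {1..d - 1} \<and> r i \<in> sym_inf (e i) \<and> s i \<in> sym_inf (d - e i)"
    "\<And>n. h n = (\<Sum>i<k. r i n * s i n)"
proof -
  from assms obtain k :: nat and e r s where *: "(\<forall>i<k. e i \<in> {1..d - 1} \<and> r i \<in> sym_inf (e i) \<and> s i \<in> sym_inf (d - e i)) \<and>
      (\<forall>n. h n = (\<Sum>i<k. r i n * s i n))"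
    unfolding finite_strength_def has_strength_decomp_def by blast
  show thesis
    by (rule that[of k e r s]) (use * in simp_all)
qed

text \<open>The infimum of a set of extended naturals coming from natural numbers is infinite only
  if the set is empty.\<close>

lemma strength_eq_infinity_iff: "strength d q = \<infinity> \<longleftrightarrow> \<not> finite_strength d q"
proof
  assume "strength d q = \<infinity>"
  show "\<not> finite_strength d q"
  proof
    assume "finite_strength d q"
    then obtain k where "has_strength_decomp d q k" by (auto simp: finite_strength_def)
    then have "strength d q \<le> enat k" unfolding strength_def by (intro Inf_lower) auto
    then show False using \<open>strength d q = \<infinity>\<close> by simp
  qed
next
  assume "\<not> finite_strength d q"
  then show "strength d q = \<infinity>" 
    by (simp add: finite_strength_def strength_def Inf_enat_def)
qed

lemma finite_strength_0: "finite_strength d (\<lambda>n. 0)"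
  by (auto simp: finite_strength_def has_strength_decomp_def intro!: exI[of _ 0])

lemma finite_strength_mult:
  assumes "1 \<le> i" "i < d" "r \<in> sym_inf i" "s \<in> sym_inf (d - i)"
  shows "finite_strength d (\<lambda>n. r n * s n)"
  unfolding finite_strength_def has_strength_decomp_def
  by (rule exI[of _ 1], rule exI[of _ "\<lambda>_. i"], rule exI[of _ "\<lambda>_. r"], rule exI[of _ "\<lambda>_. s"])
    (use assms in auto)

lemma finite_strength_add:
  assumes "finite_strength d h" "finite_strength d h'"
  shows "finite_strength d (\<lambda>n. h n + h' n)"
proof -
  obtain k :: nat and e r s where 1: "\<And>i. i < k \<Longrightarrow> e i \<in> {1..d - 1} \<and> r i \<in> sym_inf (e i) \<and> s i \<in> sym_inf (d - e i)"
      "\<And>n. h n = (\<Sum>i<k. r i n * s i n)"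
    using finite_strengthE[OF assms(1)] by blast
  obtain k' :: nat and e' r' s' where 2: "\<And>i. i < k' \<Longrightarrow> e' i \<in> {1..d - 1} \<and> r' i \<in> sym_inf (e' i) \<and> s' i \<in> sym_inf (d - e' i)"
      "\<And>n. h' n = (\<Sum>i<k'. r' i n * s' i n)"
    using finite_strengthE[OF assms(2)] by blast
  \<comment> \<open>The two decompositions are concatenated: an index \<open>i \<ge> k\<close>
    stands for entry \<open>i - k\<close> of the second one.\<close>
  define E where "E i = (if i < k then e i else e' (i - k))" for i
  define R where "R i = (if i < k then r i else r' (i - k))" for i
  define S where "S i = (if i < k then s i else s' (i - k))" for i
  have "\<forall>i<k + k'. E i \<in> {1..d - 1} \<and> R i \<in> sym_inf (E i) \<and> S i \<in> sym_inf (d - E i)"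
    using 1(1) 2(1) by (auto simp: E_def R_def S_def)
  moreover have "h n + h' n = (\<Sum>i<k + k'. R i n * S i n)" for n
  proof -
    have "(\<Sum>i<k + k'. R i n * S i n) = (\<Sum>i<k. R i n * S i n) + (\<Sum>i<k'. R (k + i) n * S (k + i) n)"
      by (induction k') (simp_all add: add.assoc)
    then show ?thesis by (simp add: 1(2) 2(2) R_def S_def)
  qed
  ultimately show ?thesis unfolding finite_strength_def has_strength_decomp_def by blast
qed

lemma finite_strength_sum:
  "(\<And>i. i \<in> I \<Longrightarrow> finite_strength d (h i)) \<Longrightarrow> finite_strength d (\<lambda>n. \<Sum>i\<in>I. h i n)"
  by (induction I rule: infinite_finite_induct) (auto intro: finite_strength_0 finite_strength_add)

lemma finite_strength_scale:
  fixes h :: "nat \<Rightarrow> 'a::field mpoly"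
  assumes inf: "infinite (UNIV :: 'a set)" and "finite_strength d h"
  shows "finite_strength d (\<lambda>n. Poly_Mapping.single 0 c * h n)"
proof -
  obtain k :: nat and e r s where 1: "\<And>i. i < k \<Longrightarrow> e i \<in> {1..d - 1} \<and> r i \<in> sym_inf (e i) \<and> s i \<in> sym_inf (d - e i)"
      "\<And>n. h n = (\<Sum>i<k. r i n * s i n)"
    using finite_strengthE[OF assms(2)] by blast
  have "finite_strength d (\<lambda>n. \<Sum>i<k. Poly_Mapping.single 0 c * r i n * s i n)"
  proof (rule finite_strength_sum)
    fix i assume "i \<in> {..<k}"
    then show "finite_strength d (\<lambda>n. Poly_Mapping.single 0 c * r i n * s i n)"
      using 1(1)[of i] by (intro finite_strength_mult[of "e i"] sym_inf_scale[OF inf]) auto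
  qed
  then show ?thesis by (simp add: 1(2) sum_distrib_left mult.assoc)
qed

section \<open>First-order expansion modulo finite strength\<close>

lemma poly_eq_infinite:
  fixes P Q :: "'a::idom poly"
  assumes inf: "infinite (UNIV :: 'a set)" and eq: "\<And>s. poly P s = poly Q s"
  shows "P = Q"
proof (rule ccontr)
  assume "P \<noteq> Q"
  then have "finite {s. poly (P - Q) s = 0}" by (intro poly_roots_finite) simp
  moreover have "{s. poly (P - Q) s = 0} = UNIV" using eq by simp
  ultimately show False using inf by simp
qed

text \<open>Leading coefficients relative to degree bounds: if one of the bounds is not attained,
  both sides are 0.\<close>

lemma coeff_mult_of_degree_le:
  assumes "degree P \<le> m" "degree Q \<le> n"
  shows "coeff (P * Q) (m + n) = coeff P m * coeff Q n"
proof (cases "degree P = m \<and> degree Q = n")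
  case True
  then show ?thesis using coeff_mult_degree_sum[of P Q] by simp
next
  case False
  then have "degree (P * Q) < m + n"
    using assms degree_mult_le[of P Q] by linarith
  moreover have "coeff P m * coeff Q n = 0"
    using False assms by (auto simp: coeff_eq_0 le_less)
  ultimately show ?thesis by (simp add: coeff_eq_0)
qed

lemma degree_coeff_prod:
  assumes "finite I" "\<And>i. i \<in> I \<Longrightarrow> degree (f i) \<le> e i \<and> coeff (f i) (e i) = c i"
  shows "degree (prod f I) \<le> sum e I \<and> coeff (prod f I) (sum e I) = prod c I"
  using assms
proof (induction I rule: finite_induct)
  case (insert i I)
  then have *: "degree (f i) \<le> e i" "coeff (f i) (e i) = c i"
    "degree (prod f I) \<le> sum e I" "coeff (prod f I) (sum e I) = prod c I" by auto
  have "coeff (f i * prod f I) (e i + sum e I) = c i * prod c I"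
    using coeff_mult_of_degree_le[OF *(1,3)] *(2,4) by simp
  moreover have "degree (f i * prod f I) \<le> e i + sum e I"
    using order.trans[OF degree_mult_le add_mono[OF *(1,3)]] .
  ultimately show ?case using insert by simp
qed auto

text \<open>Each factor \<open>[:a j, z j:]\<close> has degree at most 1 with coefficient
  \<open>z j\<close> there, so a monomial \<open>m\<close> of degree \<open>e\<close> contributes
  \<open>mon_eval z m\<close> to the coefficient of \<open>s ^ e\<close>.\<close>

lemma mpoly_eval_line:
  fixes p :: "'a::field mpoly"
  assumes p: "p \<in> sym_pow e n"
  obtains P where "degree P \<le> e" "coeff P e = mpoly_eval z p"
    "\<And>s. poly P s = mpoly_eval (\<lambda>j. a j + s * z j) p"
proof -
  define F where "F m = (\<Prod>j\<in>Poly_Mapping.keys m. [:a j, z j:] ^ Poly_Mapping.lookup m j)" for m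
  define P where "P = (\<Sum>m\<in>Poly_Mapping.keys p. Polynomial.smult (Poly_Mapping.lookup p m) (F m))"
  have F: "degree (F m) \<le> e \<and> coeff (F m) e = mon_eval z m" if m: "m \<in> Poly_Mapping.keys p" for m
  proof -
    have "degree ([:a j, z j:] ^ k) \<le> k \<and> coeff ([:a j, z j:] ^ k) k = z j ^ k" for j k
      using degree_coeff_prod[of "{..<k}" "\<lambda>_. [:a j, z j:]" "\<lambda>_. 1" "\<lambda>_. z j"] by simp
    then show ?thesis
      using degree_coeff_prod[of "Poly_Mapping.keys m" "\<lambda>j. [:a j, z j:] ^ Poly_Mapping.lookup m j"
          "Poly_Mapping.lookup m" "\<lambda>j. z j ^ Poly_Mapping.lookup m j"] p m
      by (simp add: F_def sym_pow_def mon_degree_def mon_eval_def)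
  qed
  show ?thesis
  proof (rule that[of P])
    show "degree P \<le> e" unfolding P_def
      using F by (intro degree_sum_le) (auto intro: order.trans[OF degree_smult_le])
    show "coeff P e = mpoly_eval z p"
      using F by (simp add: P_def coeff_sum mpoly_eval_def)
    show "poly P s = mpoly_eval (\<lambda>j. a j + s * z j) p" for s
      by (simp add: P_def F_def poly_sum poly_prod mpoly_eval_def mon_eval_def mult.commute)
  qed
qed

text \<open>The grading in \<open>s\<close> and the degree of the coefficients run in parallel, and
  both add up in the convolution.\<close>

lemma coeff_mult_sym_pow:
  assumes "\<And>k. coeff P k \<in> sym_pow k n" "\<And>k. coeff Q k \<in> sym_pow k n"
  shows "coeff (P * Q) k \<in> sym_pow k n"
  unfolding coeff_mult
proof (rule sym_pow_sum)
  fix i assume "i \<in> {..k}"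
  then show "coeff P i * coeff Q (k - i) \<in> sym_pow k n"
    using sym_pow_mult[OF assms(1)[of i] assms(2)[of "k - i"]] by simp
qed

lemma coeff_power_sym_pow:
  assumes "\<And>k. coeff P k \<in> sym_pow k n"
  shows "coeff (P ^ m) k \<in> sym_pow k n"
proof (induction m arbitrary: k)
  case (Suc m)
  then show ?case using coeff_mult_sym_pow[OF assms Suc] by simp
qed (auto simp: coeff_1)

lemma coeff_prod_sym_pow:
  assumes "\<And>i k. i \<in> I \<Longrightarrow> coeff (P i) k \<in> sym_pow k n"
  shows "coeff (prod P I) k \<in> sym_pow k n"
  using assms
proof (induction I arbitrary: k rule: infinite_finite_induct)
  case (insert i I)
  have "coeff (P i * prod P I) k \<in> sym_pow k n"
    by (rule coeff_mult_sym_pow) (use insert in auto)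
  then show ?case using insert by simp
qed (auto simp: coeff_1)

lemma mpoly_eval_poly:
  "mpoly_eval w (poly P (Poly_Mapping.single 0 s)) = poly (map_poly (mpoly_eval w) P) s"
  by (induction P) (simp_all add: map_poly_pCons)

text \<open>A line with symbolic direction: the \<open>x j\<close> are linear forms in
  \<open>w\<close>, while the base point \<open>a\<close> is scalar. In each factor
  \<open>y j\<close> the power of \<open>s\<close> equals the degree in \<open>w\<close>, and
  products preserve this.\<close>

lemma formal_line:
  fixes p :: "'a::field mpoly"
  assumes x: "\<And>j. x j \<in> sym_pow 1 n"
  obtains P where "\<And>k. coeff P k \<in> sym_pow k n"
    "\<And>s w. mpoly_eval w (poly P (Poly_Mapping.single 0 s)) = mpoly_eval (\<lambda>j. a j + s * mpoly_eval w (x j)) p"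
proof -
  define y where "y j = [:Poly_Mapping.single 0 (a j), x j:]" for j
  define P where "P = (\<Sum>m\<in>Poly_Mapping.keys p. [:Poly_Mapping.single 0 (Poly_Mapping.lookup p m):] *
      (\<Prod>j\<in>Poly_Mapping.keys m. y j ^ Poly_Mapping.lookup m j))"
  have c: "coeff [:Poly_Mapping.single 0 c:] k \<in> sym_pow k n" for c :: 'a and k
    by (auto simp: coeff_pCons sym_pow_single split: nat.splits)
  have y: "coeff (y j) k \<in> sym_pow k n" for j k
    using x by (auto simp: y_def coeff_pCons sym_pow_single split: nat.splits)
  show ?thesis
  proof (rule that[of P])
    show "coeff P k \<in> sym_pow k n" for k
      unfolding P_def coeff_sum
      by (intro sym_pow_sum coeff_mult_sym_pow c coeff_prod_sym_pow coeff_power_sym_pow y)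
    show "mpoly_eval w (poly P (Poly_Mapping.single 0 s)) = mpoly_eval (\<lambda>j. a j + s * mpoly_eval w (x j)) p" for s w
      by (simp add: P_def y_def poly_sum poly_prod) (simp add: mpoly_eval_def mon_eval_def)
  qed
qed

text \<open>
  Modulo the elements of finite strength, a family \<open>P\<close> of polynomials in \<open>s\<close> behaves like the
  dual number \<open>c + l \<epsilon>\<close>, with the \<open>d\<close>-th coefficient of \<open>P\<close> in the role of the coefficient of \<open>\<epsilon>\<close>.
\<close>

definition first_order ::
    "(nat \<Rightarrow> 'a::field mpoly) \<Rightarrow> nat \<Rightarrow> (nat \<Rightarrow> 'a mpoly poly) \<Rightarrow> 'a \<Rightarrow> 'a \<Rightarrow> bool" where
  "first_order q d P c l \<longleftrightarrow>
     (\<forall>k. (\<lambda>n. coeff (P n) k) \<in> sym_inf k) \<and>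
     (\<forall>n. coeff (P n) 0 = Poly_Mapping.single 0 c) \<and>
     finite_strength d (\<lambda>n. coeff (P n) d - Poly_Mapping.single 0 l * q n)"

context
  fixes q :: "nat \<Rightarrow> 'a::field mpoly" and d :: nat
  assumes inf: "infinite (UNIV :: 'a set)" and d: "d \<ge> 1"
begin

lemma first_order_const: "first_order q d (\<lambda>n. [:Poly_Mapping.single 0 c:]) c 0"
  using d by (auto simp: first_order_def coeff_pCons sym_inf_const sym_inf_0 finite_strength_0 split: nat.splits)

lemma first_order_add:
  assumes "first_order q d P c l" "first_order q d P' c' l'"
  shows "first_order q d (\<lambda>n. P n + P' n) (c + c') (l + l')"
proof -
  have eq: "coeff (P n) d + coeff (P' n) d - Poly_Mapping.single 0 (l + l') * q n =
      (coeff (P n) d - Poly_Mapping.single 0 l * q n) + (coeff (P' n) d - Poly_Mapping.single 0 l' * q n)" for n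
    by (simp add: single_add distrib_right)
  have "finite_strength d (\<lambda>n. coeff (P n) d + coeff (P' n) d - Poly_Mapping.single 0 (l + l') * q n)"
    unfolding eq by (rule finite_strength_add) (use assms in \<open>auto simp: first_order_def\<close>)
  then show ?thesis
    using assms by (auto simp: first_order_def single_add sym_inf_add[OF inf])
qed

text \<open>The product rule of dual numbers. In the \<open>d\<close>-th coefficient of the product,
  the extreme terms of the convolution give \<open>c\<close> and \<open>c'\<close> times the
  \<open>d\<close>-th coefficient of the other factor. Every middle term multiplies elements of
  degrees \<open>i\<close> and \<open>d - i\<close> with \<open>1 \<le> i < d\<close>, so their sum
  \<open>A\<close> has finite strength.\<close>

lemma first_order_mult:
  assumes P: "first_order q d P c l" and P': "first_order q d P' c' l'"
  shows "first_order q d (\<lambda>n. P n * P' n) (c * c') (c * l' + l * c')"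
proof -
  let ?k = "Poly_Mapping.single 0 :: 'a \<Rightarrow> 'a mpoly"
  define A where "A n = (\<Sum>i = 1..<d. coeff (P n) i * coeff (P' n) (d - i))" for n
  have in_sym: "(\<lambda>n. coeff (P n) k) \<in> sym_inf k" "(\<lambda>n. coeff (P' n) k) \<in> sym_inf k" for k
    using P P' by (auto simp: first_order_def)
  have 0: "coeff (P n) 0 = ?k c" "coeff (P' n) 0 = ?k c'" for n
    using P P' by (auto simp: first_order_def)
  have "coeff (P n * P' n) d = ?k c * coeff (P' n) d + (?k c' * coeff (P n) d + A n)" for n
  proof -
    have "{..d} = insert 0 (insert d {1..<d})" using d by auto
    then show ?thesis using d by (simp add: coeff_mult A_def 0 mult.commute)
  qed
  then have eq: "coeff (P n * P' n) d - ?k (c * l' + l * c') * q n =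
      ?k c * (coeff (P' n) d - ?k l' * q n) + (?k c' * (coeff (P n) d - ?k l * q n) + A n)" for n
    by (simp add: algebra_simps single_add mult_single flip: mult.assoc)
  have "finite_strength d A"
    unfolding A_def by (intro finite_strength_sum, rule finite_strength_mult) (auto simp: in_sym)
  then have "finite_strength d (\<lambda>n. coeff (P n * P' n) d - ?k (c * l' + l * c') * q n)"
    unfolding eq using P P'
    by (intro finite_strength_add finite_strength_scale[OF inf]) (auto simp: first_order_def)
  moreover have "(\<lambda>n. coeff (P n * P' n) k) \<in> sym_inf k" for k
    unfolding coeff_mult
  proof (rule sym_inf_sum[OF inf])
    fix i assume "i \<in> {..k}"
    then show "(\<lambda>n. coeff (P n) i * coeff (P' n) (k - i)) \<in> sym_inf k"
      using sym_inf_mult[OF inf in_sym(1)[of i] in_sym(2)[of "k - i"]] by simp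
  qed
  ultimately show ?thesis
    by (simp add: first_order_def coeff_mult_0 0 mult_single)
qed

lemma first_order_sum:
  assumes "\<And>i. i \<in> I \<Longrightarrow> first_order q d (P i) (c i) (l i)"
  shows "first_order q d (\<lambda>n. \<Sum>i\<in>I. P i n) (sum c I) (sum l I)"
  using assms
proof (induction I rule: infinite_finite_induct)
  case (insert i I)
  then show ?case using first_order_add[of "P i" "c i" "l i"] by simp
qed (use first_order_const[of 0] in auto)

lemma first_order_power:
  assumes "first_order q d P c l"
  shows "first_order q d (\<lambda>n. P n ^ k) (c ^ k) (of_nat k * c ^ (k - 1) * l)"
proof (induction k)
  case 0
  then show ?case using first_order_const[of 1] by (simp add: one_pCons)
next
  case (Suc k)
  \<comment> \<open>For \<open>k = 0\<close> the truncated exponent \<open>k - 1\<close> is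
    harmless, since the factor \<open>of_nat k\<close> is 0.\<close>
  have "c * (of_nat k * c ^ (k - 1) * l) + l * c ^ k = of_nat (Suc k) * c ^ (Suc k - 1) * l"
    by (cases k) (simp_all add: algebra_simps)
  then show ?case using first_order_mult[OF assms Suc] by simp
qed

lemma first_order_prod:
  assumes "finite I" "\<And>i. i \<in> I \<Longrightarrow> first_order q d (P i) (c i) (l i)"
  shows "first_order q d (\<lambda>n. \<Prod>i\<in>I. P i n) (prod c I) (\<Sum>i\<in>I. l i * prod c (I - {i}))"
  using assms
proof (induction I rule: finite_induct)
  case empty
  then show ?case using first_order_const[of 1] by (simp add: one_pCons)
next
  case (insert j I)
  have "(\<Sum>i\<in>I. l i * prod c (insert j I - {i})) = (\<Sum>i\<in>I. c j * (l i * prod c (I - {i})))"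
  proof (rule sum.cong)
    fix i assume "i \<in> I"
    then have "insert j I - {i} = insert j (I - {i})" "j \<notin> I - {i}" using insert.hyps by auto
    then show "l i * prod c (insert j I - {i}) = c j * (l i * prod c (I - {i}))"
      using insert.hyps(1) by (simp add: mult_ac)
  qed simp
  moreover have "insert j I - {j} = I" using insert.hyps by auto
  ultimately have eq: "(\<Sum>i\<in>insert j I. l i * prod c (insert j I - {i})) =
      c j * (\<Sum>i\<in>I. l i * prod c (I - {i})) + l j * prod c I"
    using insert.hyps by (simp add: sum_distrib_left)
  have "first_order q d (\<lambda>n. P j n * (\<Prod>i\<in>I. P i n)) (c j * prod c I)
      (c j * (\<Sum>i\<in>I. l i * prod c (I - {i})) + l j * prod c I)"
    by (rule first_order_mult) (use insert in auto)
  then show ?case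
    unfolding eq using insert.hyps by simp
qed

text \<open>Expansion in \<open>s\<close> of \<open>q\<close> at \<open>a + s b w\<close>, with
  \<open>a\<close> cut to \<open>m\<close> and \<open>w\<close> to \<open>n\<close> coordinates. The
  constant term is \<open>q(a)\<close> and the coefficient of \<open>s ^ d\<close> is exactly
  \<open>b ^ d\<close> times \<open>q(w)\<close>, so the error of finite strength is 0 here.\<close>

lemma first_order_line:
  assumes q: "q \<in> sym_inf d"
  shows "\<exists>P. first_order q d P (mpoly_eval a (q m)) (b ^ d) \<and>
    (\<forall>n s w. mpoly_eval w (poly (P n) (Poly_Mapping.single 0 s)) =
       mpoly_eval (\<lambda>j. trunc m a j + s * (b * trunc n w j)) (q (n + m)))"
proof -
  define x where "x n j = (if j < n then Poly_Mapping.single (Poly_Mapping.single j 1) b else 0 :: 'a mpoly)" for n j :: nat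
  have x_in: "x n j \<in> sym_pow 1 n" for n j
    by (auto simp: x_def sym_pow_single)
  have x_eval: "mpoly_eval w (x n j) = b * trunc n w j" for w n j
    by (auto simp: x_def trunc_def)
  \<comment> \<open>The component \<open>n + m\<close> of \<open>q\<close> has room for the supports
    of both \<open>trunc m a\<close> and \<open>trunc n w\<close>.\<close>
  have "\<exists>Q. (\<forall>k. coeff Q k \<in> sym_pow k n) \<and> (\<forall>s w. mpoly_eval w (poly Q (Poly_Mapping.single 0 s)) =
       mpoly_eval (\<lambda>j. trunc m a j + s * (b * trunc n w j)) (q (n + m)))" for n
    using formal_line[of "x n" n "trunc m a" "q (n + m)", OF x_in] unfolding x_eval by metis
  then obtain P where P: "\<And>n k. coeff (P n) k \<in> sym_pow k n"
    and ev: "\<And>n s w. mpoly_eval w (poly (P n) (Poly_Mapping.single 0 s)) =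
       mpoly_eval (\<lambda>j. trunc m a j + s * (b * trunc n w j)) (q (n + m))"
    by metis
  have coeff_ev: "mpoly_eval w (coeff (P n) k) = coeff (map_poly (mpoly_eval w) (P n)) k" for n w k
    by (simp add: coeff_map_poly)
  have "(\<lambda>n. coeff (P n) k) \<in> sym_inf k" for k
    unfolding sym_inf_iff[OF inf]
  proof (intro conjI allI P)
    fix n w
    \<comment> \<open>Both sides evaluate \<open>q\<close> at the same vector, supported below
      \<open>n + m\<close>. They agree for every \<open>s\<close>, hence coefficient by
      coefficient.\<close>
    have "map_poly (mpoly_eval (trunc n w)) (P (Suc n)) = map_poly (mpoly_eval w) (P n)"
    proof (rule poly_eq_infinite[OF inf])
      fix s
      let ?v = "\<lambda>j. trunc m a j + s * (b * trunc n w j)"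
      have v: "trunc (n + m) ?v = ?v" by (auto simp: trunc_def)
      have "mpoly_eval ?v (q (Suc n + m)) = mpoly_eval ?v (q (n + m))"
        using mpoly_eval_sym_inf[OF inf q, of "n + m" "Suc n + m" ?v] unfolding v by simp
      then show "poly (map_poly (mpoly_eval (trunc n w)) (P (Suc n))) s = poly (map_poly (mpoly_eval w) (P n)) s"
        unfolding mpoly_eval_poly[symmetric] ev by (simp add: min_def)
    qed
    then show "mpoly_eval (trunc n w) (coeff (P (Suc n)) k) = mpoly_eval w (coeff (P n) k)"
      unfolding coeff_ev by simp
  qed
  moreover have "coeff (P n) 0 = Poly_Mapping.single 0 (mpoly_eval a (q m))" for n
    unfolding mpoly_eq_iff_eval[OF inf]
  proof
    fix w
    have "mpoly_eval w (coeff (P n) 0) = poly (map_poly (mpoly_eval w) (P n)) 0"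
      by (simp add: coeff_ev poly_0_coeff_0)
    also have "\<dots> = mpoly_eval (trunc m a) (q (n + m))"
      unfolding mpoly_eval_poly[symmetric] ev by simp
    also have "\<dots> = mpoly_eval a (q m)"
      by (rule mpoly_eval_sym_inf[OF inf q]) simp
    finally show "mpoly_eval w (coeff (P n) 0) = mpoly_eval w (Poly_Mapping.single 0 (mpoly_eval a (q m)))"
      by simp
  qed
  moreover have "coeff (P n) d = Poly_Mapping.single 0 (b ^ d) * q n" for n
    unfolding mpoly_eq_iff_eval[OF inf]
  proof
    fix w
    \<comment> \<open>The numerical line polynomial \<open>R\<close> identifies the top coefficient
      as the value of \<open>q\<close> in the direction of the line.\<close>
    obtain R where R: "coeff R d = mpoly_eval (\<lambda>j. b * trunc n w j) (q (n + m))"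
      "\<And>s. poly R s = mpoly_eval (\<lambda>j. trunc m a j + s * (b * trunc n w j)) (q (n + m))"
      using mpoly_eval_line[OF sym_infD[OF q, of "n + m"], of "\<lambda>j. b * trunc n w j" "trunc m a"] by metis
    have "map_poly (mpoly_eval w) (P n) = R"
      by (rule poly_eq_infinite[OF inf]) (simp add: mpoly_eval_poly[symmetric] ev R)
    then have "mpoly_eval w (coeff (P n) d) = mpoly_eval (\<lambda>j. b * trunc n w j) (q (n + m))"
      by (simp add: coeff_ev R)
    also have "\<dots> = b ^ d * mpoly_eval (trunc n w) (q (n + m))"
      by (rule mpoly_eval_scale[OF sym_infD[OF q]])
    also have "mpoly_eval (trunc n w) (q (n + m)) = mpoly_eval w (q n)"
      by (rule mpoly_eval_sym_inf[OF inf q]) simp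
    finally show "mpoly_eval w (coeff (P n) d) = mpoly_eval w (Poly_Mapping.single 0 (b ^ d) * q n)"
      by simp
  qed
  ultimately have "first_order q d P (mpoly_eval a (q m)) (b ^ d)"
    by (simp add: first_order_def finite_strength_0)
  then show ?thesis by (intro exI[of _ P] conjI allI ev)
qed

end

section \<open>Equations of minimal degree\<close>

definition exponents :: "'i set \<Rightarrow> nat \<Rightarrow> ('i \<Rightarrow>\<^sub>0 nat) set" where
  "exponents I D = {m. Poly_Mapping.keys m \<subseteq> I \<and> (\<Sum>i\<in>I. Poly_Mapping.lookup m i) \<le> D}"

text \<open>A polynomial of degree at most \<open>D\<close> in the coordinates \<open>I\<close>,
  given by its coefficient function; values of \<open>a\<close> outside \<open>exponents I D\<close>
  are ignored.\<close>

definition cpoly :: "'i set \<Rightarrow> nat \<Rightarrow> (('i \<Rightarrow>\<^sub>0 nat) \<Rightarrow> 'a) \<Rightarrow> ('i \<Rightarrow> 'a) \<Rightarrow> 'a::field" where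
  "cpoly I D a x = (\<Sum>m\<in>exponents I D. a m * mon_eval x m)"

text \<open>The formal partial derivative along \<open>i\<close>, on coefficient functions. It
  lowers the degree bound from \<open>Suc D\<close> to \<open>D\<close>.\<close>

definition cderiv :: "'i \<Rightarrow> (('i \<Rightarrow>\<^sub>0 nat) \<Rightarrow> 'a) \<Rightarrow> ('i \<Rightarrow>\<^sub>0 nat) \<Rightarrow> 'a::field" where
  "cderiv i a m = of_nat (Suc (Poly_Mapping.lookup m i)) * a (m + Poly_Mapping.single i 1)"

definition is_cpoly :: "'i set \<Rightarrow> (('i \<Rightarrow> 'a::field) \<Rightarrow> 'a) \<Rightarrow> bool" where
  "is_cpoly I F \<longleftrightarrow> (\<exists>D a. \<forall>x. F x = cpoly I D a x)"

lemma keys_add_single: "Poly_Mapping.keys (m + Poly_Mapping.single i (1::nat)) = insert i (Poly_Mapping.keys m)"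
  by (auto simp: in_keys_iff lookup_add lookup_single when_def split: if_splits)

lemma eq_add_single:
  assumes "Poly_Mapping.lookup m i \<noteq> (0::nat)"
  obtains m' where "m = m' + Poly_Mapping.single i 1"
proof (rule that)
  show "m = (m - Poly_Mapping.single i 1) + Poly_Mapping.single i 1"
    using assms by (intro poly_mapping_eqI) (auto simp: lookup_add lookup_minus lookup_single when_def)
qed

context
  fixes I :: "'i set"
  assumes I: "finite I"
begin

lemma exponents_0 [simp]: "exponents I 0 = {0}"
proof -
  have "m = 0" if "Poly_Mapping.keys m \<subseteq> I" "\<forall>i\<in>I. Poly_Mapping.lookup m i = 0" for m :: "'i \<Rightarrow>\<^sub>0 nat"
    using that by (metis in_keys_iff lookup_zero poly_mapping_eqI subsetD)
  then show ?thesis using I by (auto simp: exponents_def)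
qed

lemma sum_lookup_add_single:
  assumes "i \<in> I"
  shows "(\<Sum>j\<in>I. Poly_Mapping.lookup (m + Poly_Mapping.single i 1) j) = Suc (\<Sum>j\<in>I. Poly_Mapping.lookup m j)"
proof -
  have "(\<Sum>j\<in>I. Poly_Mapping.lookup (m + Poly_Mapping.single i 1) j) =
      (\<Sum>j\<in>I. Poly_Mapping.lookup m j) + (\<Sum>j\<in>I. if i = j then 1 else 0)"
    unfolding sum.distrib[symmetric] by (intro sum.cong) (auto simp: lookup_add lookup_single when_def)
  then show ?thesis using assms I by simp
qed

lemma add_single_in_exponents:
  assumes "i \<in> I"
  shows "m + Poly_Mapping.single i 1 \<in> exponents I (Suc D) \<longleftrightarrow> m \<in> exponents I D"
  unfolding exponents_def mem_Collect_eq sum_lookup_add_single[OF assms] keys_add_single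
  using assms by auto

lemma finite_exponents: "finite (exponents I D)"
proof (induction D)
  case (Suc D)
  have "exponents I (Suc D) \<subseteq> insert 0 (\<Union>i\<in>I. (\<lambda>m. m + Poly_Mapping.single i 1) ` exponents I D)"
  proof
    fix m assume m: "m \<in> exponents I (Suc D)"
    show "m \<in> insert 0 (\<Union>i\<in>I. (\<lambda>m. m + Poly_Mapping.single i 1) ` exponents I D)"
    proof (cases "m = 0")
      case False
      then obtain i where i: "Poly_Mapping.lookup m i \<noteq> 0"
        by (metis lookup_zero poly_mapping_eqI)
      then have "i \<in> I" using m by (auto simp: exponents_def in_keys_iff)
      moreover obtain m' where "m = m' + Poly_Mapping.single i 1"
        using eq_add_single[OF i] .
      ultimately show ?thesis using m add_single_in_exponents by auto
    qed simp
  qed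
  then show ?case using Suc I by (auto intro: finite_subset)
qed simp

lemma exponents_mono: "D \<le> D' \<Longrightarrow> exponents I D \<subseteq> exponents I D'"
  by (auto simp: exponents_def)

text \<open>The coefficient at \<open>\<alpha>\<close> is a combination of values, and these are all
  0.\<close>

lemma cpoly_eq_0_imp:
  fixes a :: "('i \<Rightarrow>\<^sub>0 nat) \<Rightarrow> 'a::field"
  assumes inf: "infinite (UNIV :: 'a set)" and 0: "\<And>x. cpoly I D a x = 0" and \<alpha>: "\<alpha> \<in> exponents I D"
  shows "a \<alpha> = 0"
proof -
  obtain U and b :: "('i \<Rightarrow> 'a) \<Rightarrow> 'a" where b:
    "\<And>m. (\<And>i. i \<in> I \<Longrightarrow> m i \<le> D) \<Longrightarrow> (\<Sum>u\<in>U. b u * (\<Prod>i\<in>I. u i ^ m i)) =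
      (if \<forall>i\<in>I. m i = Poly_Mapping.lookup \<alpha> i then 1 else 0)"
    using multivariate_coeff_functional[OF inf I, of D "Poly_Mapping.lookup \<alpha>"] by blast
  have eq: "(\<Sum>u\<in>U. b u * mon_eval u m) = (if m = \<alpha> then 1 else 0)" if m: "m \<in> exponents I D" for m
  proof -
    have "(\<forall>i\<in>I. Poly_Mapping.lookup m i = Poly_Mapping.lookup \<alpha> i) \<longleftrightarrow> m = \<alpha>"
      using m \<alpha> unfolding exponents_def mem_Collect_eq by (metis in_keys_iff poly_mapping_eqI subsetD)
    moreover have "Poly_Mapping.lookup m i \<le> D" if "i \<in> I" for i
      using m member_le_sum[OF that, of "Poly_Mapping.lookup m"] I by (auto simp: exponents_def)
    ultimately show ?thesis
      using b[of "Poly_Mapping.lookup m"] m I by (simp add: mon_eval_superset exponents_def)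
  qed
  have "0 = (\<Sum>u\<in>U. b u * cpoly I D a u)" by (simp add: 0)
  also have "\<dots> = (\<Sum>m\<in>exponents I D. a m * (\<Sum>u\<in>U. b u * mon_eval u m))"
    unfolding cpoly_def sum_distrib_left by (subst sum.swap) (simp add: mult_ac)
  also have "\<dots> = (\<Sum>m\<in>exponents I D. if m = \<alpha> then a m else 0)"
    by (intro sum.cong) (auto simp: eq)
  also have "\<dots> = a \<alpha>" using \<alpha> finite_exponents by simp
  finally show ?thesis by simp
qed

text \<open>Dividing all exponents by \<open>p\<close> and taking \<open>p\<close>-th roots of the
  coefficients gives \<open>b\<close>; the roots exist because Frobenius is surjective, and since it
  is additive the \<open>p\<close>-th power of the new sum is the old one.\<close>

lemma cpoly_root:
  fixes a :: "('i \<Rightarrow>\<^sub>0 nat) \<Rightarrow> 'a::field"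
  assumes perfect: "surj (\<lambda>x::'a. x ^ p)" and p: "p = CHAR('a)" "p > 0"
    and a: "\<And>m i. m \<in> exponents I D \<Longrightarrow> a m \<noteq> 0 \<Longrightarrow> i \<in> I \<Longrightarrow> p dvd Poly_Mapping.lookup m i"
  obtains b where "\<And>x. cpoly I D a x = cpoly I (D div p) b x ^ p"
proof -
  define S where "S m = Poly_Mapping.map ((*) p) m" for m :: "'i \<Rightarrow>\<^sub>0 nat"
  have S: "Poly_Mapping.lookup (S m) i = p * Poly_Mapping.lookup m i" for m i
    by (simp add: S_def Poly_Mapping.map.rep_eq when_def)
  have keys_S: "Poly_Mapping.keys (S m) = Poly_Mapping.keys m" for m
    using p by (auto simp: in_keys_iff S)
  have inj: "inj_on S M" for M
    using p by (intro inj_onI poly_mapping_eqI) (metis S nat_mult_eq_cancel1)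
  have S_in: "S m \<in> exponents I D \<longleftrightarrow> m \<in> exponents I (D div p)" for m
    using p by (simp add: exponents_def keys_S S flip: sum_distrib_left)
      (simp add: less_eq_div_iff_mult_less_eq mult.commute)
  have "mon_eval x (S m) = mon_eval x m ^ p" for x :: "'i \<Rightarrow> 'a" and m
    by (simp add: mon_eval_def keys_S S prod_power_distrib mult.commute flip: power_mult)
  define b where "b m = inv_into UNIV (\<lambda>x. x ^ p) (a (S m))" for m
  have b: "b m ^ p = a (S m)" for m
    using surj_f_inv_f[OF perfect, of "a (S m)"] by (simp add: b_def)
  have "prime CHAR('a)" using p by (simp add: prime_CHAR_semidom)
  have "cpoly I D a x = cpoly I (D div p) b x ^ p" for x
  proof -
    have "cpoly I D a x = (\<Sum>m\<in>S ` exponents I (D div p). a m * mon_eval x m)"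
      unfolding cpoly_def
    proof (rule sum.mono_neutral_right[OF finite_exponents])
      show "S ` exponents I (D div p) \<subseteq> exponents I D" using S_in by auto
      show "\<forall>m\<in>exponents I D - S ` exponents I (D div p). a m * mon_eval x m = 0"
      proof
        fix m assume m: "m \<in> exponents I D - S ` exponents I (D div p)"
        have "a m = 0"
        proof (rule ccontr)
          assume "a m \<noteq> 0"
          \<comment> \<open>Exponents outside \<open>I\<close> are 0, so every exponent is a
            multiple of \<open>p\<close> and the quotient \<open>m'\<close> is exact.\<close>
          define m' where "m' = Poly_Mapping.map (\<lambda>k. k div p) m"
          have "m = S m'"
          proof (rule poly_mapping_eqI)
            fix i
            have "p dvd Poly_Mapping.lookup m i"
            proof (cases "i \<in> I")
              case True
              then show ?thesis using a[of m i] \<open>a m \<noteq> 0\<close> m by simp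
            next
              case False
              then have "Poly_Mapping.lookup m i = 0"
                using m unfolding exponents_def by (auto simp: in_keys_iff)
              then show ?thesis by simp
            qed
            moreover have "Poly_Mapping.lookup m' i = Poly_Mapping.lookup m i div p"
              by (simp add: m'_def Poly_Mapping.map.rep_eq when_def)
            ultimately show "Poly_Mapping.lookup m i = Poly_Mapping.lookup (S m') i"
              by (simp add: S)
          qed
          then show False using m S_in[of m'] by blast
        qed
        then show "a m * mon_eval x m = 0" by simp
      qed
    qed
    also have "\<dots> = (\<Sum>m\<in>exponents I (D div p). (b m * mon_eval x m) ^ p)"
      by (subst sum.reindex[OF inj])
        (simp add: b power_mult_distrib \<open>\<And>x m. mon_eval x (S m) = mon_eval x m ^ p\<close>)
    also have "\<dots> = cpoly I (D div p) b x ^ p"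
      unfolding cpoly_def by (rule freshmans_dream_sum[OF \<open>prime CHAR('a)\<close> p(1), symmetric])
    finally show ?thesis .
  qed
  then show ?thesis by (rule that)
qed

text \<open>Descent on the degree bound. If a partial derivative is nonzero somewhere on
  \<open>X\<close>, the search ends; if one is nonzero only off \<open>X\<close>, it replaces the
  equation. If all of them vanish identically, the equation is a \<open>p\<close>-th power, and its
  \<open>p\<close>-th root replaces it.\<close>

lemma separating_derivative:
  fixes a :: "('i \<Rightarrow>\<^sub>0 nat) \<Rightarrow> 'a::field"
  assumes inf: "infinite (UNIV :: 'a set)" and perfect: "perfect_field TYPE('a)" and X: "X \<noteq> {}"
    and "\<And>x. x \<in> X \<Longrightarrow> cpoly I D a x = 0" and "cpoly I D a y \<noteq> 0"
  shows "\<exists>D b i. i \<in> I \<and> (\<forall>x\<in>X. cpoly I (Suc D) b x = 0) \<and> (\<exists>x\<in>X. cpoly I D (cderiv i b) x \<noteq> 0)"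
  using assms(4,5)
proof (induction D arbitrary: a y rule: less_induct)
  case (less D)
  \<comment> \<open>A constant vanishing on the nonempty set \<open>X\<close> would be 0, contrary
    to the value at \<open>y\<close>.\<close>
  have not_const: "\<exists>m\<in>exponents I D. m \<noteq> 0 \<and> a m \<noteq> 0"
  proof (rule ccontr)
    assume *: "\<not> ?thesis"
    have "cpoly I D a x = (\<Sum>m\<in>{0}. a m * mon_eval x m)" for x
      unfolding cpoly_def using * finite_exponents exponents_mono[of 0 D]
      by (intro sum.mono_neutral_right) auto
    then have "cpoly I D a x = a 0" for x by simp
    then show False using X less.prems by force
  qed
  then have "D \<noteq> 0" by (cases D) auto
  then obtain D' where D': "D = Suc D'" by (cases D) auto
  show ?case
  proof (cases "\<exists>i\<in>I. \<exists>x. cpoly I D' (cderiv i a) x \<noteq> 0")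
    case True
    then obtain i x where i: "i \<in> I" "cpoly I D' (cderiv i a) x \<noteq> 0" by blast
    show ?thesis
    proof (cases "\<exists>x\<in>X. cpoly I D' (cderiv i a) x \<noteq> 0")
      case True
      then show ?thesis using i less.prems(1) D' by blast
    next
      case False
      then show ?thesis using less.IH[of D' "cderiv i a"] i D' by blast
    qed
  next
    case False
    \<comment> \<open>The derivatives vanish coefficient by coefficient, and up to a shift the
      coefficients of \<open>cderiv i a\<close> are those of \<open>a\<close> times the exponent of
      \<open>i\<close>.\<close>
    have zero: "of_nat (Poly_Mapping.lookup m i) = (0::'a)" if m: "m \<in> exponents I D" "a m \<noteq> 0" "i \<in> I" for m i
    proof (cases "Poly_Mapping.lookup m i = 0")
      case nz: False
      obtain m' where m': "m = m' + Poly_Mapping.single i 1" using eq_add_single[OF nz] .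
      then have "m' \<in> exponents I D'" using m D' add_single_in_exponents by auto
      then have "cderiv i a m' = 0" using False m cpoly_eq_0_imp[OF inf, of D' "cderiv i a" m'] by blast
      then show ?thesis using m(2) by (simp add: cderiv_def m' lookup_add)
    qed simp
    let ?p = "CHAR('a)"
    have dvd: "?p dvd Poly_Mapping.lookup m i" if "m \<in> exponents I D" "a m \<noteq> 0" "i \<in> I" for m i
      using zero[OF that] by (simp add: of_nat_eq_0_iff_char_dvd)
    \<comment> \<open>In characteristic 0 the exponents would be divisible by 0, hence all 0,
      contrary to \<open>not_const\<close>.\<close>
    have "?p \<noteq> 0"
    proof
      assume "?p = 0"
      obtain m where m: "m \<in> exponents I D" "m \<noteq> 0" "a m \<noteq> 0" using not_const by blast
      then obtain i where i: "Poly_Mapping.lookup m i \<noteq> 0"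
        by (metis lookup_zero poly_mapping_eqI)
      then have "i \<in> I" using m by (auto simp: exponents_def in_keys_iff)
      then show False using dvd[OF m(1,3)] i \<open>?p = 0\<close> by auto
    qed
    then have "surj (\<lambda>x::'a. x ^ ?p)" using perfect by (simp add: perfect_field_def)
    then obtain b where b: "\<And>x. cpoly I D a x = cpoly I (D div ?p) b x ^ ?p"
      using cpoly_root[OF _ refl, of D a] dvd \<open>?p \<noteq> 0\<close> by blast
    have "?p \<noteq> 1" using CHAR_not_1' by simp
    then have "1 < ?p" using \<open>?p \<noteq> 0\<close> by linarith
    then have "D div ?p < D" using D' by (intro div_less_dividend) auto
    then show ?thesis
    proof (rule less.IH)
      show "cpoly I (D div ?p) b x = 0" if "x \<in> X" for x
        using less.prems(1)[OF that] by (simp add: b)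
      show "cpoly I (D div ?p) b y \<noteq> 0"
        using less.prems(2) \<open>?p \<noteq> 0\<close> by (auto simp: b)
    qed
  qed
qed

text \<open>Termwise differentiation, reindexed by raising the exponent of \<open>i\<close> by one.
  Monomials free of \<open>i\<close> drop out because of the factor \<open>of_nat 0\<close>.\<close>

lemma sum_cderiv:
  assumes i: "i \<in> I"
  shows "(\<Sum>m\<in>exponents I (Suc D). a m * (of_nat (Poly_Mapping.lookup m i) *
      c i ^ (Poly_Mapping.lookup m i - 1) * (\<Prod>j\<in>I - {i}. c j ^ Poly_Mapping.lookup m j))) =
    cpoly I D (cderiv i a) c" (is "sum ?f _ = _")
proof -
  let ?s = "\<lambda>m. m + Poly_Mapping.single i 1 :: 'i \<Rightarrow>\<^sub>0 nat"
  have "sum ?f (exponents I (Suc D)) = sum ?f (?s ` exponents I D)"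
  proof (rule sum.mono_neutral_right[OF finite_exponents])
    show "?s ` exponents I D \<subseteq> exponents I (Suc D)"
      using add_single_in_exponents[OF i] by auto
    show "\<forall>m\<in>exponents I (Suc D) - ?s ` exponents I D. ?f m = 0"
    proof
      fix m assume m: "m \<in> exponents I (Suc D) - ?s ` exponents I D"
      have "Poly_Mapping.lookup m i = 0"
      proof (rule ccontr)
        assume *: "Poly_Mapping.lookup m i \<noteq> 0"
        obtain m' where "m = ?s m'" using eq_add_single[OF *] .
        then show False using m add_single_in_exponents[OF i] by auto
      qed
      then show "?f m = 0" by simp
    qed
  qed
  also have "\<dots> = (\<Sum>m\<in>exponents I D. ?f (?s m))"
    by (subst sum.reindex) (auto simp: inj_on_def)
  also have "\<dots> = (\<Sum>m\<in>exponents I D. cderiv i a m * mon_eval c m)"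
  proof (rule sum.cong)
    fix m assume "m \<in> exponents I D"
    then have "mon_eval c m = (\<Prod>j\<in>I. c j ^ Poly_Mapping.lookup m j)"
      using I by (intro mon_eval_superset) (auto simp: exponents_def)
    also have "\<dots> = c i ^ Poly_Mapping.lookup m i * (\<Prod>j\<in>I - {i}. c j ^ Poly_Mapping.lookup m j)"
      by (rule prod.remove[OF I i])
    also have "(\<Prod>j\<in>I - {i}. c j ^ Poly_Mapping.lookup m j) =
        (\<Prod>j\<in>I - {i}. c j ^ Poly_Mapping.lookup (?s m) j)"
      by (intro prod.cong) (auto simp: lookup_add lookup_single when_def)
    finally show "?f (?s m) = cderiv i a m * mon_eval c m"
      by (simp add: cderiv_def lookup_add mult_ac)
  qed simp
  finally show ?thesis by (simp add: cpoly_def)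
qed

text \<open>The chain rule: inserting the dual numbers \<open>c i + l i \<epsilon>\<close> into a
  polynomial yields its value at \<open>c\<close> plus \<open>\<epsilon>\<close> times its
  directional derivative along \<open>l\<close>.\<close>

lemma first_order_cpoly:
  fixes q :: "nat \<Rightarrow> 'a::field mpoly"
  assumes inf: "infinite (UNIV :: 'a set)" and d: "d \<ge> 1"
    and P: "\<And>i. i \<in> I \<Longrightarrow> first_order q d (P i) (c i) (l i)"
  shows "first_order q d
      (\<lambda>n. \<Sum>m\<in>exponents I (Suc D). [:Poly_Mapping.single 0 (a m):] * (\<Prod>i\<in>I. P i n ^ Poly_Mapping.lookup m i))
      (cpoly I (Suc D) a c) (\<Sum>i\<in>I. l i * cpoly I D (cderiv i a) c)"
proof -
  let ?l = "\<lambda>m i. of_nat (Poly_Mapping.lookup m i) * c i ^ (Poly_Mapping.lookup m i - 1) * l i"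
  let ?pr = "\<lambda>m i. \<Prod>j\<in>I - {i}. c j ^ Poly_Mapping.lookup m j"
  \<comment> \<open>The summand \<open>0 * ...\<close> comes from the product rule: the coefficients
    \<open>a m\<close> are constants, with \<open>\<epsilon>\<close>-part 0.\<close>
  have "first_order q d
      (\<lambda>n. \<Sum>m\<in>exponents I (Suc D). [:Poly_Mapping.single 0 (a m):] * (\<Prod>i\<in>I. P i n ^ Poly_Mapping.lookup m i))
      (\<Sum>m\<in>exponents I (Suc D). a m * (\<Prod>i\<in>I. c i ^ Poly_Mapping.lookup m i))
      (\<Sum>m\<in>exponents I (Suc D). a m * (\<Sum>i\<in>I. ?l m i * ?pr m i) + 0 * (\<Prod>i\<in>I. c i ^ Poly_Mapping.lookup m i))"
    by (intro first_order_sum[OF inf d] first_order_mult[OF inf d] first_order_const[OF inf d]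
        first_order_prod[OF inf d] first_order_power[OF inf d] I P)
  moreover have "(\<Sum>m\<in>exponents I (Suc D). a m * (\<Prod>i\<in>I. c i ^ Poly_Mapping.lookup m i)) = cpoly I (Suc D) a c"
    unfolding cpoly_def using I by (intro sum.cong) (auto simp: mon_eval_superset exponents_def)
  moreover have "(\<Sum>m\<in>exponents I (Suc D). a m * (\<Sum>i\<in>I. ?l m i * ?pr m i) + 0 * (\<Prod>i\<in>I. c i ^ Poly_Mapping.lookup m i)) =
      (\<Sum>i\<in>I. l i * (\<Sum>m\<in>exponents I (Suc D). a m * (of_nat (Poly_Mapping.lookup m i) *
      c i ^ (Poly_Mapping.lookup m i - 1) * ?pr m i)))"
    unfolding sum_distrib_left by (subst sum.swap) (simp add: mult_ac)
  ultimately show ?thesis using sum_cderiv[of _ a c D] by simp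
qed

section \<open>Polynomial functions in finitely many coordinates\<close>

lemma is_cpoly_monom:
  assumes "Poly_Mapping.keys m \<subseteq> I"
  shows "is_cpoly I (\<lambda>x. c * mon_eval x m)"
proof -
  let ?D = "\<Sum>i\<in>I. Poly_Mapping.lookup m i"
  have "m \<in> exponents I ?D" using assms by (simp add: exponents_def)
  have "cpoly I ?D (\<lambda>k. if k = m then c else 0) x = c * mon_eval x m" for x
  proof -
    have "cpoly I ?D (\<lambda>k. if k = m then c else 0) x = (\<Sum>k\<in>exponents I ?D. if k = m then c * mon_eval x k else 0)"
      unfolding cpoly_def by (intro sum.cong) auto
    then show ?thesis using \<open>m \<in> exponents I ?D\<close> finite_exponents by simp
  qed
  then show ?thesis unfolding is_cpoly_def by metis
qed

lemma cpoly_extend: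
  assumes "D \<le> D'"
  shows "cpoly I D a x = cpoly I D' (\<lambda>m. if m \<in> exponents I D then a m else 0) x"
  unfolding cpoly_def
  by (rule sum.mono_neutral_cong_left[OF finite_exponents exponents_mono[OF assms]]) simp_all

lemma is_cpoly_add:
  assumes "is_cpoly I F" "is_cpoly I G"
  shows "is_cpoly I (\<lambda>x. F x + G x)"
proof -
  obtain D a D' b where F: "\<And>x. F x = cpoly I D a x" and G: "\<And>x. G x = cpoly I D' b x"
    using assms unfolding is_cpoly_def by blast
  let ?a = "\<lambda>m. if m \<in> exponents I D then a m else 0"
  let ?b = "\<lambda>m. if m \<in> exponents I D' then b m else 0"
  have "F x + G x = cpoly I (max D D') (\<lambda>m. ?a m + ?b m) x" for x
    unfolding F G cpoly_extend[of D "max D D'", OF max.cobounded1] cpoly_extend[of D' "max D D'", OF max.cobounded2]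
    by (simp add: cpoly_def sum.distrib distrib_right)
  then show ?thesis unfolding is_cpoly_def by (intro exI allI)
qed

lemma is_cpoly_sum:
  assumes "\<And>k. k \<in> M \<Longrightarrow> is_cpoly I (F k)"
  shows "is_cpoly I (\<lambda>x. \<Sum>k\<in>M. F k x)"
  using assms
proof (induction M rule: infinite_finite_induct)
  case (insert k M)
  then show ?case by (simp add: is_cpoly_add)
qed (use is_cpoly_monom[of 0 0] in auto)

lemma is_cpoly_mult:
  assumes "is_cpoly I F" "is_cpoly I G"
  shows "is_cpoly I (\<lambda>x. F x * G x)"
proof -
  obtain D a D' b where F: "\<And>x. F x = cpoly I D a x" and G: "\<And>x. G x = cpoly I D' b x"
    using assms unfolding is_cpoly_def by blast
  have "F x * G x = (\<Sum>m\<in>exponents I D. \<Sum>m'\<in>exponents I D'. (a m * b m') * mon_eval x (m + m'))" for x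
    by (simp add: F G cpoly_def sum_product mon_eval_add mult_ac)
  moreover have "is_cpoly I (\<lambda>x. \<Sum>m\<in>exponents I D. \<Sum>m'\<in>exponents I D'. (a m * b m') * mon_eval x (m + m'))"
  proof (intro is_cpoly_sum is_cpoly_monom)
    fix m m' assume "m \<in> exponents I D" "m' \<in> exponents I D'"
    then show "Poly_Mapping.keys (m + m') \<subseteq> I"
      using Poly_Mapping.keys_add[of m m'] by (auto simp: exponents_def)
  qed
  ultimately show ?thesis by simp
qed

end

text \<open>Bridge from the topology to the descent on degrees: on \<open>E\<close> only the
  coordinates in \<open>I\<close> can be nonzero, so all others may be replaced by 0.\<close>

lemma poly_funs_cpoly:
  assumes "f \<in> poly_funs" and I: "finite I"
    and E: "\<And>p \<alpha>. p \<in> E \<Longrightarrow> \<alpha> \<notin> I \<Longrightarrow> Poly_Mapping.lookup p \<alpha> = 0"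
  obtains D a where "\<And>p. p \<in> E \<Longrightarrow> f p = cpoly I D a (Poly_Mapping.lookup p)"
proof -
  have "\<exists>F. is_cpoly I F \<and> (\<forall>p\<in>E. f p = F (Poly_Mapping.lookup p))"
    using assms(1)
  proof (induction rule: poly_funs.induct)
    case (const c)
    show ?case
      by (intro exI[of _ "\<lambda>x. c * mon_eval x 0"] conjI is_cpoly_monom[OF I]) auto
  next
    case (coord \<alpha>)
    show ?case
    proof (cases "\<alpha> \<in> I")
      case True
      then show ?thesis
        by (intro exI[of _ "\<lambda>x. 1 * mon_eval x (Poly_Mapping.single \<alpha> 1)"] conjI is_cpoly_monom[OF I]) auto
    next
      case False
      then show ?thesis
        by (intro exI[of _ "\<lambda>x. 0 * mon_eval x 0"] conjI is_cpoly_monom[OF I]) (auto simp: E)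
    qed
  next
    case (add f g)
    then obtain F G where "is_cpoly I F" "\<forall>p\<in>E. f p = F (Poly_Mapping.lookup p)"
      "is_cpoly I G" "\<forall>p\<in>E. g p = G (Poly_Mapping.lookup p)" by blast
    then show ?case
      by (intro exI[of _ "\<lambda>x. F x + G x"] conjI is_cpoly_add[OF I]) auto
  next
    case (mult f g)
    then obtain F G where "is_cpoly I F" "\<forall>p\<in>E. f p = F (Poly_Mapping.lookup p)"
      "is_cpoly I G" "\<forall>p\<in>E. g p = G (Poly_Mapping.lookup p)" by blast
    then show ?case
      by (intro exI[of _ "\<lambda>x. F x * G x"] conjI is_cpoly_mult[OF I]) auto
  qed
  then show ?thesis using that unfolding is_cpoly_def by metis
qed

section \<open>Equations force finite strength\<close>

definition linear_form :: "nat \<Rightarrow> (nat \<Rightarrow> 'a) \<Rightarrow> 'a::field mpoly" where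
  "linear_form n \<tau> = (\<Sum>i<n. Poly_Mapping.single (Poly_Mapping.single i 1) (\<tau> i))"

lemma mpoly_eval_linear_form: "mpoly_eval w (linear_form n \<tau>) = (\<Sum>i<n. w i * \<tau> i)"
  by (simp add: linear_form_def mult.commute)

lemma linear_form_power_in_sym_pow: "linear_form n \<tau> ^ d \<in> sym_pow d n"
proof -
  have "linear_form n \<tau> \<in> sym_pow 1 n"
    unfolding linear_form_def by (intro sym_pow_sum sym_pow_single) auto
  then show ?thesis using sym_pow_power by fastforce
qed

text \<open>Polarisation: the linear factors of a \<open>d\<close>-th power are traded one by one
  for variables, and at \<open>e = d\<close> every monomial is reached. In one trade
  \<open>l\<close> becomes \<open>l + t x\<close>, with \<open>x\<close> a variable, and the
  coefficient of \<open>t\<close> is extracted.\<close>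

lemma linear_functional_vanishing_on_powers:
  fixes \<phi> :: "'a::field mpoly \<Rightarrow> 'a"
  assumes inf: "infinite (UNIV :: 'a set)" and char: "CHAR('a) = 0 \<or> CHAR('a) > d"
    and add: "\<And>x y. \<phi> (x + y) = \<phi> x + \<phi> y"
    and scale: "\<And>c x. \<phi> (Poly_Mapping.single 0 c * x) = c * \<phi> x"
    and 0: "\<And>\<tau>. \<phi> (linear_form n \<tau> ^ d) = 0"
    and "e \<le> d" "mon_degree \<beta> = e" "Poly_Mapping.keys \<beta> \<subseteq> {..<n}"
  shows "\<phi> (Poly_Mapping.single \<beta> 1 * linear_form n \<tau> ^ (d - e)) = 0"
  using assms(6-8)
proof (induction e arbitrary: \<beta> \<tau>)
  case 0
  then show ?case using assms(5) by (simp add: mon_degree_eq_0_iff)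
next
  case (Suc e)
  define k where "k = d - Suc e"
  have k: "d - e = Suc k" using Suc.prems(1) by (simp add: k_def)
  have "\<beta> \<noteq> 0" using Suc.prems(2) by auto
  then obtain i where i: "Poly_Mapping.lookup \<beta> i \<noteq> 0"
    by (metis lookup_zero poly_mapping_eqI)
  obtain \<gamma> where \<gamma>: "\<beta> = \<gamma> + Poly_Mapping.single i 1" using eq_add_single[OF i] .
  have i': "i < n" using i Suc.prems(3) by (meson in_keys_iff lessThan_iff subsetD)
  have \<gamma>': "mon_degree \<gamma> = e" "Poly_Mapping.keys \<gamma> \<subseteq> {..<n}"
    using Suc.prems(2,3) unfolding \<gamma> keys_add_single by (auto simp: mon_degree_add)
  define x :: "'a mpoly" where "x = Poly_Mapping.single (Poly_Mapping.single i 1) 1"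
  define l where "l = linear_form n \<tau>"
  have \<phi>_0: "\<phi> 0 = 0" using scale[of 0 0] by simp
  have \<phi>_sum: "\<phi> (\<Sum>j\<in>J. h j) = (\<Sum>j\<in>J. \<phi> (h j))" for J :: "nat set" and h
    by (induction J rule: infinite_finite_induct) (auto simp: add \<phi>_0)
  \<comment> \<open>\<open>c j\<close> is the coefficient of \<open>t ^ j\<close> in
    \<open>\<phi>\<close> of the monomial \<open>\<gamma>\<close> times
    \<open>(t x + l) ^ Suc k\<close>, which is 0 for all \<open>t\<close> by the induction
    hypothesis.\<close>
  define c where "c j = of_nat (Suc k choose j) * \<phi> (Poly_Mapping.single \<gamma> 1 * (x ^ j * l ^ (Suc k - j)))" for j
  define P where "P = (\<Sum>j\<le>Suc k. monom (c j) j)"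
  have "P = 0"
  proof (rule poly_eq_infinite[OF inf])
    fix t
    have "linear_form n (\<lambda>j. \<tau> j + (if j = i then t else 0)) =
        l + (\<Sum>j<n. if j = i then Poly_Mapping.single (Poly_Mapping.single j 1) t else 0)"
      unfolding linear_form_def l_def sum.distrib[symmetric] by (intro sum.cong) (auto simp: single_add)
    also have "\<dots> = Poly_Mapping.single 0 t * x + l"
      using i' by (simp add: x_def mult_single)
    finally have lin: "linear_form n (\<lambda>j. \<tau> j + (if j = i then t else 0)) = Poly_Mapping.single 0 t * x + l" .
    have pow: "(Poly_Mapping.single 0 t :: 'a mpoly) ^ j = Poly_Mapping.single 0 (t ^ j)" for j
      by (induction j) (auto simp: mult_single)
    have coef: "of_nat N * Poly_Mapping.single 0 r = Poly_Mapping.single (0 :: nat \<Rightarrow>\<^sub>0 nat) (of_nat N * r)"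
      for N and r :: 'a
      by (simp add: mult_single flip: single_of_nat)
    have "0 = \<phi> (Poly_Mapping.single \<gamma> 1 * (Poly_Mapping.single 0 t * x + l) ^ Suc k)"
      using Suc.IH[OF _ \<gamma>'] Suc.prems(1) unfolding lin[symmetric] k by simp
    also have "Poly_Mapping.single \<gamma> 1 * (Poly_Mapping.single 0 t * x + l) ^ Suc k =
        (\<Sum>j\<le>Suc k. Poly_Mapping.single 0 (of_nat (Suc k choose j) * t ^ j) *
        (Poly_Mapping.single \<gamma> 1 * (x ^ j * l ^ (Suc k - j))))"
      unfolding binomial_ring sum_distrib_left
    proof (rule sum.cong)
      fix j
      have "Poly_Mapping.single \<gamma> 1 * (of_nat (Suc k choose j) * (Poly_Mapping.single 0 t * x) ^ j * l ^ (Suc k - j)) =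
          (of_nat (Suc k choose j) * Poly_Mapping.single 0 (t ^ j)) *
          (Poly_Mapping.single \<gamma> 1 * (x ^ j * l ^ (Suc k - j)))"
        by (simp only: power_mult_distrib pow mult_ac)
      then show "Poly_Mapping.single \<gamma> 1 * (of_nat (Suc k choose j) * (Poly_Mapping.single 0 t * x) ^ j * l ^ (Suc k - j)) =
          Poly_Mapping.single 0 (of_nat (Suc k choose j) * t ^ j) *
          (Poly_Mapping.single \<gamma> 1 * (x ^ j * l ^ (Suc k - j)))"
        by (simp only: coef)
    qed simp
    also have "\<phi> \<dots> = (\<Sum>j\<le>Suc k. of_nat (Suc k choose j) * t ^ j *
        \<phi> (Poly_Mapping.single \<gamma> 1 * (x ^ j * l ^ (Suc k - j))))"
      by (simp only: \<phi>_sum scale)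
    also have "\<dots> = poly P t"
      unfolding P_def poly_sum poly_monom c_def by (intro sum.cong) (simp_all add: mult_ac)
    finally show "poly P t = poly 0 t" by simp
  qed
  then have "coeff P 1 = 0" by simp
  moreover have "coeff P 1 = c 1"
    by (simp add: P_def coeff_sum del: sum.atMost_Suc)
  \<comment> \<open>\<open>Suc k = d - e\<close> lies between 1 and \<open>d\<close>, so the
    characteristic does not divide it.\<close>
  moreover have "(of_nat (Suc k) :: 'a) \<noteq> 0"
    using char Suc.prems(1) k by (auto simp: of_nat_eq_0_iff_char_dvd simp del: of_nat_Suc dest: dvd_imp_le)
  ultimately have "\<phi> (Poly_Mapping.single \<gamma> 1 * (x * l ^ k)) = 0"
    by (simp add: c_def)
  then show ?case
    by (simp add: \<gamma> x_def l_def k_def mult_single flip: mult.assoc)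
qed

lemma finite_strength_if_equation:
  fixes q :: "nat \<Rightarrow> 'a::field mpoly"
  assumes inf: "infinite (UNIV :: 'a set)" and perfect: "perfect_field TYPE('a)"
    and char: "CHAR('a) = 0 \<or> CHAR('a) > d" and d: "d \<ge> 1" and q: "q \<in> sym_inf d"
    and f: "f \<in> poly_funs" and p\<^sub>0: "p\<^sub>0 \<in> sym_pow d n" "f p\<^sub>0 \<noteq> 0"
    and vanish: "\<And>m A. A \<in> carrier_mat n m \<Longrightarrow> f (sym_map A (q m)) = 0"
  shows "finite_strength d q"
proof -
  \<comment> \<open>The finitely many coordinates of \<open>sym_pow d n\<close>.\<close>
  define I where "I = {\<alpha>. mon_degree \<alpha> = d \<and> Poly_Mapping.keys \<alpha> \<subseteq> {..<n}}"
  have "I \<subseteq> exponents {..<n} d"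
    by (auto simp: I_def exponents_def mon_degree_superset[of "{..<n}"])
  then have I: "finite I" using finite_exponents[of "{..<n}"] finite_subset by blast
  have outside: "Poly_Mapping.lookup p \<alpha> = 0" if "p \<in> sym_pow d n" "\<alpha> \<notin> I" for p :: "'a mpoly" and \<alpha>
    using that unfolding sym_pow_def I_def by (auto simp: in_keys_iff)
  have img: "sym_map A (q m) \<in> sym_pow d n" if "A \<in> carrier_mat n m" for A m
    using sym_map_in_sym_pow[OF sym_infD[OF q, of m], of A] that by simp
  define X where "X = {Poly_Mapping.lookup (sym_map A (q m)) | A m. A \<in> carrier_mat n m}"
  obtain D\<^sub>0 a\<^sub>0 where a\<^sub>0: "\<And>p. p \<in> sym_pow d n \<Longrightarrow> f p = cpoly I D\<^sub>0 a\<^sub>0 (Poly_Mapping.lookup p)"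
    using poly_funs_cpoly[OF f I outside] by blast
  have X: "X \<noteq> {}" unfolding X_def using zero_carrier_mat by blast
  have zero: "cpoly I D\<^sub>0 a\<^sub>0 x = 0" if "x \<in> X" for x
    using that a\<^sub>0 img vanish unfolding X_def by force
  have nonzero: "cpoly I D\<^sub>0 a\<^sub>0 (Poly_Mapping.lookup p\<^sub>0) \<noteq> 0"
    using a\<^sub>0 p\<^sub>0 by simp
  obtain D a \<beta> x where \<beta>: "\<beta> \<in> I" and a: "\<forall>x\<in>X. cpoly I (Suc D) a x = 0"
    and "x \<in> X" and x: "cpoly I D (cderiv \<beta> a) x \<noteq> 0"
    using separating_derivative[OF I inf perfect X zero nonzero] by blast
  obtain A m where A: "A \<in> carrier_mat n m" and x_eq: "x = Poly_Mapping.lookup (sym_map A (q m))"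
    using \<open>x \<in> X\<close> unfolding X_def by blast
  \<comment> \<open>The differential of the equation \<open>a\<close> at the point
    \<open>x\<close>.\<close>
  define \<phi> where "\<phi> p = (\<Sum>\<alpha>\<in>I. Poly_Mapping.lookup p \<alpha> * cpoly I D (cderiv \<alpha> a) x)" for p
  have "\<exists>\<tau>. \<phi> (linear_form n \<tau> ^ d) \<noteq> 0"
  proof (rule ccontr)
    assume "\<not> ?thesis"
    then have zero: "\<phi> (linear_form n \<tau> ^ d) = 0" for \<tau> by simp
    have add: "\<phi> (p + r) = \<phi> p + \<phi> r" for p r
      by (simp add: \<phi>_def lookup_add distrib_right sum.distrib)
    have "Poly_Mapping.lookup (Poly_Mapping.single 0 c * p) \<alpha> = c * Poly_Mapping.lookup p \<alpha>"
      for c and p :: "'a mpoly" and \<alpha>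
      by (simp add: Poly_Mapping.map.rep_eq when_def flip: mult_map_scale_conv_mult)
    then have scale: "\<phi> (Poly_Mapping.single 0 c * p) = c * \<phi> p" for c p
      by (simp add: \<phi>_def sum_distrib_left mult.assoc)
    \<comment> \<open>The exponent \<open>d - d\<close> leaves the bare monomial
      \<open>\<beta>\<close>, on which \<open>\<phi>\<close> is the derivative known to be nonzero
      at \<open>x\<close>.\<close>
    have "\<phi> (Poly_Mapping.single \<beta> 1 * linear_form n (\<lambda>_. 0) ^ (d - d)) = 0"
      using linear_functional_vanishing_on_powers[OF inf char add scale zero order.refl] \<beta> by (simp add: I_def)
    moreover have "\<phi> (Poly_Mapping.single \<beta> 1) = (\<Sum>\<alpha>\<in>I. if \<alpha> = \<beta> then cpoly I D (cderiv \<alpha> a) x else 0)"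
      unfolding \<phi>_def by (intro sum.cong) (auto simp: lookup_single when_def)
    ultimately show False using \<beta> I x by simp
  qed
  then obtain \<tau> where \<tau>: "\<phi> (linear_form n \<tau> ^ d) \<noteq> 0" by blast
  \<comment> \<open>\<open>A\<close> padded by \<open>N\<close> zero columns, plus \<open>s\<close>
    times the rank-one matrix \<open>\<tau> w^T\<close> with \<open>w\<close> cut to
    \<open>N\<close> coordinates.\<close>
  define B where "B N s w = mat n (N + m)
      (\<lambda>(i, j). trunc m (\<lambda>j. A $$ (i, j)) j + s * (\<tau> i * trunc N w j))" for N s w
  have B: "B N s w \<in> carrier_mat n (N + m)" for N s w by (simp add: B_def)
  have "\<exists>P. first_order q d P (x \<alpha>) (Poly_Mapping.lookup (linear_form n \<tau> ^ d) \<alpha>) \<and>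
      (\<forall>N s w. mpoly_eval w (poly (P N) (Poly_Mapping.single 0 s)) =
        Poly_Mapping.lookup (sym_map (B N s w) (q (N + m))) \<alpha>)" for \<alpha>
  proof -
    obtain U and b :: "(nat \<Rightarrow> 'a) \<Rightarrow> 'a" where
      "\<forall>p\<in>sym_pow d n. Poly_Mapping.lookup p \<alpha> = (\<Sum>u\<in>U. b u * mpoly_eval u p)"
      using sym_pow_coeff_functional[OF inf, of d n \<alpha>] by (elim exE) (rule that)
    then have lookup: "Poly_Mapping.lookup p \<alpha> = (\<Sum>u\<in>U. b u * mpoly_eval u p)" if "p \<in> sym_pow d n" for p
      using that by blast
    \<comment> \<open>\<open>v u\<close> is the row vector \<open>u A\<close>, and
      \<open>u B\<close> equals \<open>u A\<close> plus \<open>s\<close> times the pairing of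
      \<open>u\<close> and \<open>\<tau>\<close> times \<open>w\<close>. So
      \<open>first_order_line\<close> applies with this pairing as \<open>b\<close>.\<close>
    define v where "v u j = (\<Sum>i<n. u i * A $$ (i, j))" for u j
    have "\<exists>P. first_order q d P (mpoly_eval (v u) (q m)) ((\<Sum>i<n. u i * \<tau> i) ^ d) \<and>
        (\<forall>N s w. mpoly_eval w (poly (P N) (Poly_Mapping.single 0 s)) =
        mpoly_eval (\<lambda>j. trunc m (v u) j + s * ((\<Sum>i<n. u i * \<tau> i) * trunc N w j)) (q (N + m)))" for u
      by (rule first_order_line[OF inf d q])
    then obtain Q where Q: "\<And>u. first_order q d (Q u) (mpoly_eval (v u) (q m)) ((\<Sum>i<n. u i * \<tau> i) ^ d)"
      and Q_ev: "\<And>u N s w. mpoly_eval w (poly (Q u N) (Poly_Mapping.single 0 s)) =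
        mpoly_eval (\<lambda>j. trunc m (v u) j + s * ((\<Sum>i<n. u i * \<tau> i) * trunc N w j)) (q (N + m))"
      by metis
    define P where "P N = (\<Sum>u\<in>U. [:Poly_Mapping.single 0 (b u):] * Q u N)" for N
    have P: "first_order q d P (\<Sum>u\<in>U. b u * mpoly_eval (v u) (q m))
        (\<Sum>u\<in>U. b u * (\<Sum>i<n. u i * \<tau> i) ^ d + 0 * mpoly_eval (v u) (q m))"
      unfolding P_def
      by (intro first_order_sum[OF inf d] first_order_mult[OF inf d] first_order_const[OF inf d] Q)
    have c_eq: "(\<Sum>u\<in>U. b u * mpoly_eval (v u) (q m)) = x \<alpha>"
      using A by (simp add: x_eq lookup[OF img[OF A]] mpoly_eval_sym_map v_def[abs_def])
    \<comment> \<open>The \<open>d\<close>-th power of the pairing is the value at \<open>u\<close>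
      of \<open>linear_form n \<tau> ^ d\<close>, so the same functional extracts its coordinate
      \<open>\<alpha>\<close>.\<close>
    have l_eq: "(\<Sum>u\<in>U. b u * (\<Sum>i<n. u i * \<tau> i) ^ d + 0 * mpoly_eval (v u) (q m)) =
        Poly_Mapping.lookup (linear_form n \<tau> ^ d) \<alpha>"
      by (simp add: lookup[OF linear_form_power_in_sym_pow] mpoly_eval_linear_form)
    have "mpoly_eval w (poly (P N) (Poly_Mapping.single 0 s)) =
        Poly_Mapping.lookup (sym_map (B N s w) (q (N + m))) \<alpha>" for N s w
    proof -
      have "mpoly_eval u (sym_map (B N s w) (q (N + m))) =
          mpoly_eval (\<lambda>j. trunc m (v u) j + s * ((\<Sum>i<n. u i * \<tau> i) * trunc N w j)) (q (N + m))" for u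
        unfolding mpoly_eval_sym_map
      proof (rule mpoly_eval_cong[OF sym_infD[OF q]])
        fix j assume j: "j < N + m"
        have "(\<Sum>i<dim_row (B N s w). u i * B N s w $$ (i, j)) =
            (\<Sum>i<n. u i * trunc m (\<lambda>j. A $$ (i, j)) j + s * (u i * \<tau> i * trunc N w j))"
          using j by (intro sum.cong) (auto simp: B_def algebra_simps)
        also have "\<dots> = trunc m (v u) j + s * ((\<Sum>i<n. u i * \<tau> i) * trunc N w j)"
          by (simp add: sum.distrib trunc_def v_def sum_distrib_left sum_distrib_right)
        finally show "(\<Sum>i<dim_row (B N s w). u i * B N s w $$ (i, j)) =
            trunc m (v u) j + s * ((\<Sum>i<n. u i * \<tau> i) * trunc N w j)" .
      qed
      then show ?thesis
        by (simp add: lookup[OF img[OF B]] P_def poly_sum Q_ev)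
    qed
    then show ?thesis
      using P unfolding c_eq l_eq by (intro exI[of _ P] conjI allI)
  qed
  then obtain P where P: "\<And>\<alpha>. first_order q d (P \<alpha>) (x \<alpha>) (Poly_Mapping.lookup (linear_form n \<tau> ^ d) \<alpha>)"
    and P_ev: "\<And>\<alpha> N s w. mpoly_eval w (poly (P \<alpha> N) (Poly_Mapping.single 0 s)) =
        Poly_Mapping.lookup (sym_map (B N s w) (q (N + m))) \<alpha>"
    by metis
  \<comment> \<open>The equation along the moving point, as a polynomial in \<open>s\<close> with
    \<open>w\<close> symbolic.\<close>
  define G where "G N = (\<Sum>k\<in>exponents I (Suc D). [:Poly_Mapping.single 0 (a k):] *
      (\<Prod>\<alpha>\<in>I. P \<alpha> N ^ Poly_Mapping.lookup k \<alpha>))" for N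
  have G: "first_order q d G (cpoly I (Suc D) a x) (\<phi> (linear_form n \<tau> ^ d))"
    unfolding G_def \<phi>_def by (intro first_order_cpoly[OF I inf d] P)
  \<comment> \<open>For all scalar \<open>s\<close> and \<open>w\<close> the moving point lies in
    \<open>X\<close>, where the equation holds; hence every coefficient of \<open>G N\<close>
    vanishes.\<close>
  have "coeff (G N) d = 0" for N
    unfolding mpoly_eq_iff_eval[OF inf]
  proof
    fix w
    have "map_poly (mpoly_eval w) (G N) = 0"
    proof (rule poly_eq_infinite[OF inf])
      fix s
      let ?y = "Poly_Mapping.lookup (sym_map (B N s w) (q (N + m)))"
      have "poly (map_poly (mpoly_eval w) (G N)) s =
          (\<Sum>k\<in>exponents I (Suc D). a k * (\<Prod>\<alpha>\<in>I. ?y \<alpha> ^ Poly_Mapping.lookup k \<alpha>))"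
        unfolding mpoly_eval_poly[symmetric] by (simp add: G_def poly_sum poly_prod P_ev)
      also have "\<dots> = cpoly I (Suc D) a ?y"
        unfolding cpoly_def using I by (intro sum.cong) (auto simp: mon_eval_superset exponents_def)
      also have "\<dots> = 0" using a B unfolding X_def by blast
      finally show "poly (map_poly (mpoly_eval w) (G N)) s = poly 0 s" by simp
    qed
    then show "mpoly_eval w (coeff (G N) d) = mpoly_eval w 0"
      by (metis coeff_0 coeff_map_poly mpoly_eval_0)
  qed
  then have "finite_strength d (\<lambda>N. - (Poly_Mapping.single 0 (\<phi> (linear_form n \<tau> ^ d)) * q N))"
    using G by (simp add: first_order_def)
  then have "finite_strength d (\<lambda>N. Poly_Mapping.single 0 (- inverse (\<phi> (linear_form n \<tau> ^ d))) *
      - (Poly_Mapping.single 0 (\<phi> (linear_form n \<tau> ^ d)) * q N))"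
    by (rule finite_strength_scale[OF inf])
  then show ?thesis
    using \<tau> by (simp add: mult_single single_uminus flip: mult.assoc)
qed

section \<open>From the orbit to all matrices\<close>

text \<open>The point at which \<open>q\<close> is evaluated by the \<open>k\<close>-th component of
  the translate: \<open>w\<close> cut to \<open>k\<close> coordinates, then multiplied from the
  right by \<open>g\<close> extended by an identity block.\<close>

definition act_vec :: "'a::field mat \<Rightarrow> nat \<Rightarrow> (nat \<Rightarrow> 'a) \<Rightarrow> nat \<Rightarrow> 'a" where
  "act_vec g k w j = (if j < dim_row g then \<Sum>i<dim_row g. trunc k w i * g $$ (i, j) else trunc k w j)"

lemma mpoly_eval_gl_act:
  assumes q: "q \<in> sym_inf d" and g: "g \<in> carrier_mat r r"
  shows "mpoly_eval w (gl_act g q k) = mpoly_eval (act_vec g k w) (q (max k r))"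
proof -
  let ?N = "max k r"
  let ?D = "diag_embed ?N g"
  have dim: "dim_row ?D = ?N" using g by (simp add: diag_embed_def Let_def)
  have "mpoly_eval w (gl_act g q k) = mpoly_eval (trunc k w) (sym_map ?D (q ?N))"
    using sym_map_in_sym_pow[OF sym_infD[OF q], of ?D ?N] g dim
    by (simp add: gl_act_def Let_def mpoly_eval_proj)
  also have "\<dots> = mpoly_eval (act_vec g k w) (q ?N)"
    unfolding mpoly_eval_sym_map dim
  proof (rule mpoly_eval_cong[OF sym_infD[OF q]])
    fix j assume j: "j < ?N"
    have "(\<Sum>i<?N. trunc k w i * ?D $$ (i, j)) =
        (\<Sum>i<?N. if j < r then (if i < r then trunc k w i * g $$ (i, j) else 0)
          else (if i = j then trunc k w i else 0))"
      using g j by (intro sum.cong) (auto simp: diag_embed_def Let_def)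
    also have "\<dots> = act_vec g k w j"
    proof (cases "j < r")
      case True
      have "(\<Sum>i<?N. if i < r then trunc k w i * g $$ (i, j) else 0) = (\<Sum>i<r. trunc k w i * g $$ (i, j))"
        by (rule sum.mono_neutral_cong_right) auto
      then show ?thesis using True g by (simp add: act_vec_def)
    next
      case False
      then show ?thesis using g j by (simp add: act_vec_def)
    qed
    finally show "(\<Sum>i<?N. trunc k w i * ?D $$ (i, j)) = act_vec g k w j" .
  qed
  finally show ?thesis .
qed

lemma gl_act_in_sym_inf:
  fixes q :: "nat \<Rightarrow> 'a::field mpoly"
  assumes inf: "infinite (UNIV :: 'a set)" and q: "q \<in> sym_inf d" and g: "g \<in> carrier_mat r r"
  shows "gl_act g q \<in> sym_inf d"
  unfolding sym_inf_iff[OF inf]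
proof (intro conjI allI)
  fix k
  let ?N = "max k r"
  have "sym_map (diag_embed ?N g) (q ?N) \<in> sym_pow d (dim_row (diag_embed ?N g))"
    using sym_map_in_sym_pow[OF sym_infD[OF q]] .
  then have "sym_map (proj_mat ?N k) (sym_map (diag_embed ?N g) (q ?N)) \<in> sym_pow d (dim_row (proj_mat ?N k :: 'a mat))"
    by (rule sym_map_in_sym_pow)
  then show "gl_act g q k \<in> sym_pow d k"
    using g by (simp add: gl_act_def Let_def proj_mat_def)
next
  fix k w
  have "act_vec g (Suc k) (trunc k w) = act_vec g k w"
    by (simp add: act_vec_def fun_eq_iff)
  moreover have "trunc (max k r) (act_vec g k w) = act_vec g k w"
    using g by (auto simp: trunc_def act_vec_def fun_eq_iff)
  ultimately show "mpoly_eval (trunc k w) (gl_act g q (Suc k)) = mpoly_eval w (gl_act g q k)"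
    using mpoly_eval_sym_inf[OF inf q, of "max k r" "max (Suc k) r" "act_vec g k w"]
    by (simp add: mpoly_eval_gl_act[OF q g])
qed

lemma invertible_matI:
  assumes "g \<in> carrier_mat n n" "h \<in> carrier_mat n n" "g * h = 1\<^sub>m n" "h * g = 1\<^sub>m n"
  shows "invertible_mat g"
  using assms unfolding invertible_mat_def inverts_mat_def
  by (auto simp: square_mat.simps intro!: exI[of _ h])

text \<open>The top \<open>n\<close> rows \<open>[A | s I]\<close> are the ones of interest. The
  lower rows complete them to an invertible matrix, with explicit inverse \<open>?h\<close>.\<close>

lemma block_in_GL:
  fixes A :: "'a::field mat"
  assumes A: "A \<in> carrier_mat n m" and s: "s \<noteq> 0"
  shows "four_block_mat A (s \<cdot>\<^sub>m 1\<^sub>m n) (1\<^sub>m m) (0\<^sub>m m n) \<in> GL (n + m)"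
proof -
  let ?g = "four_block_mat A (s \<cdot>\<^sub>m 1\<^sub>m n) (1\<^sub>m m) (0\<^sub>m m n)"
  let ?h = "four_block_mat (0\<^sub>m m n) (1\<^sub>m m) (inverse s \<cdot>\<^sub>m 1\<^sub>m n) (- inverse s \<cdot>\<^sub>m A)"
  have g: "?g \<in> carrier_mat (n + m) (n + m)" using A by auto
  have h: "?h \<in> carrier_mat (n + m) (n + m)" using A by auto
  have one: "four_block_mat (1\<^sub>m a) (0\<^sub>m a b) (0\<^sub>m b a) (1\<^sub>m b) = (1\<^sub>m (a + b) :: 'a mat)" for a b
    by (rule eq_matI) auto
  have "?g * ?h = four_block_mat (A * 0\<^sub>m m n + (s \<cdot>\<^sub>m 1\<^sub>m n) * (inverse s \<cdot>\<^sub>m 1\<^sub>m n))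
      (A * 1\<^sub>m m + (s \<cdot>\<^sub>m 1\<^sub>m n) * (- inverse s \<cdot>\<^sub>m A))
      (1\<^sub>m m * 0\<^sub>m m n + 0\<^sub>m m n * (inverse s \<cdot>\<^sub>m 1\<^sub>m n)) (1\<^sub>m m * 1\<^sub>m m + 0\<^sub>m m n * (- inverse s \<cdot>\<^sub>m A))"
    using A by (intro mult_four_block_mat) auto
  also have "A * 0\<^sub>m m n + (s \<cdot>\<^sub>m 1\<^sub>m n) * (inverse s \<cdot>\<^sub>m 1\<^sub>m n) = 1\<^sub>m n"
    using A s by (intro eq_matI) auto
  also have "A * 1\<^sub>m m + (s \<cdot>\<^sub>m 1\<^sub>m n) * (- inverse s \<cdot>\<^sub>m A) = 0\<^sub>m n m"
    using A s by (intro eq_matI) auto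
  also have "1\<^sub>m m * 0\<^sub>m m n + 0\<^sub>m m n * (inverse s \<cdot>\<^sub>m 1\<^sub>m n) = (0\<^sub>m m n :: 'a mat)"
    by (intro eq_matI) auto
  also have "1\<^sub>m m * 1\<^sub>m m + 0\<^sub>m m n * (- inverse s \<cdot>\<^sub>m A) = 1\<^sub>m m"
    using A by (intro eq_matI) auto
  finally have gh: "?g * ?h = 1\<^sub>m (n + m)" by (simp add: one)
  have "?h * ?g = four_block_mat (0\<^sub>m m n * A + 1\<^sub>m m * 1\<^sub>m m) (0\<^sub>m m n * (s \<cdot>\<^sub>m 1\<^sub>m n) + 1\<^sub>m m * 0\<^sub>m m n)
      (inverse s \<cdot>\<^sub>m 1\<^sub>m n * A + - inverse s \<cdot>\<^sub>m A * 1\<^sub>m m)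
      (inverse s \<cdot>\<^sub>m 1\<^sub>m n * (s \<cdot>\<^sub>m 1\<^sub>m n) + - inverse s \<cdot>\<^sub>m A * 0\<^sub>m m n)"
    using A by (intro mult_four_block_mat) auto
  also have "0\<^sub>m m n * A + 1\<^sub>m m * 1\<^sub>m m = 1\<^sub>m m"
    using A by (intro eq_matI) auto
  also have "0\<^sub>m m n * (s \<cdot>\<^sub>m 1\<^sub>m n) + 1\<^sub>m m * 0\<^sub>m m n = 0\<^sub>m m n"
    by (intro eq_matI) auto
  also have "inverse s \<cdot>\<^sub>m 1\<^sub>m n * A + - inverse s \<cdot>\<^sub>m A * 1\<^sub>m m = 0\<^sub>m n m"
    using A by (intro eq_matI) auto
  also have "inverse s \<cdot>\<^sub>m 1\<^sub>m n * (s \<cdot>\<^sub>m 1\<^sub>m n) + - inverse s \<cdot>\<^sub>m A * 0\<^sub>m m n = 1\<^sub>m n"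
    using A s by (intro eq_matI) auto
  finally have "?h * ?g = 1\<^sub>m (n + m)" by (simp add: one add.commute)
  then show ?thesis
    unfolding GL_def using invertible_matI[OF g h gh] g by blast
qed

text \<open>Every coordinate of \<open>E s\<close> is a fixed combination of values of
  \<open>p\<close> at points moving on lines, hence polynomial in \<open>s\<close>; sums and
  products preserve this.\<close>

lemma poly_funs_line:
  fixes p :: "'a::field mpoly"
  assumes inf: "infinite (UNIV :: 'a set)" and F: "F \<in> poly_funs" and p: "p \<in> sym_pow d k"
    and E: "\<And>s. E s \<in> sym_pow d n"
      "\<And>s w. mpoly_eval w (E s) = mpoly_eval (\<lambda>j. a w j + s * z w j) p"
  shows "\<exists>P. \<forall>s. poly P s = F (E s)"
  using F
proof (induction rule: poly_funs.induct)
  case (const c)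
  show ?case by (rule exI[of _ "[:c:]"]) simp
next
  case (coord \<alpha>)
  obtain U and b :: "(nat \<Rightarrow> 'a) \<Rightarrow> 'a" where
    lookup: "\<forall>p\<in>sym_pow d n. Poly_Mapping.lookup p \<alpha> = (\<Sum>u\<in>U. b u * mpoly_eval u p)"
    using sym_pow_coeff_functional[OF inf, of d n \<alpha>] by (elim exE) (rule that)
  have "\<exists>R. \<forall>s. poly R s = mpoly_eval (\<lambda>j. a u j + s * z u j) p" for u
    using mpoly_eval_line[OF p, where z = "z u" and a = "a u"] by blast
  then obtain R where R: "\<And>u s. poly (R u) s = mpoly_eval (\<lambda>j. a u j + s * z u j) p"
    by metis
  show ?case
    by (rule exI[of _ "\<Sum>u\<in>U. Polynomial.smult (b u) (R u)"]) (simp add: poly_sum R lookup E)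
next
  case (add f g)
  then show ?case by (metis poly_add)
next
  case (mult f g)
  then show ?case by (metis poly_mult)
qed

text \<open>For \<open>s \<noteq> 0\<close>, \<open>M s\<close> is the top part of an invertible
  matrix \<open>?g\<close>, and the \<open>n\<close>-th component of the translate by
  \<open>?g\<close> depends on these rows only. Thus \<open>F (E s)\<close> is a polynomial in
  \<open>s\<close> that vanishes for \<open>s \<noteq> 0\<close>, hence also at
  \<open>s = 0\<close>, where \<open>E 0\<close> is the image under \<open>A\<close>.\<close>

lemma vanish_on_matrices_if_vanish_on_orbit:
  fixes q :: "nat \<Rightarrow> 'a::field mpoly"
  assumes inf: "infinite (UNIV :: 'a set)" and q: "q \<in> sym_inf d" and F: "F \<in> poly_funs"
    and vanish: "\<And>g r. g \<in> GL r \<Longrightarrow> F (gl_act g q n) = 0" and A: "A \<in> carrier_mat n m"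
  shows "F (sym_map A (q m)) = 0"
proof -
  define M where "M s = mat n (n + m)
      (\<lambda>(i, j). if j < m then A $$ (i, j) else if j = m + i then s else 0)" for s
  define E where "E s = sym_map (M s) (q (n + m))" for s
  \<comment> \<open>\<open>a w + s * z w\<close> is the row vector \<open>w [A | s I]\<close>, which
    moves on a line in \<open>s\<close>.\<close>
  define a where "a w = trunc m (\<lambda>j. \<Sum>i<n. w i * A $$ (i, j))" for w
  define z where "z w j = (if j < m then 0 else w (j - m))" for w :: "nat \<Rightarrow> 'a" and j
  have E_in: "E s \<in> sym_pow d n" for s
    using sym_map_in_sym_pow[OF sym_infD[OF q], of "M s" "n + m"] by (simp add: E_def M_def)
  have block_sum: "(\<Sum>i<n. w i * (if j < m then A $$ (i, j) else if j = m + i then s else 0)) = a w j + s * z w j"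
    if j: "j < n + m" for w s j
  proof (cases "j < m")
    case False
    then have "(\<Sum>i<n. w i * (if j = m + i then s else 0)) = (\<Sum>i<n. if i = j - m then w i * s else 0)"
      by (intro sum.cong) auto
    then show ?thesis using False j by (simp add: a_def trunc_def z_def)
  qed (simp add: a_def trunc_def z_def)
  have E_ev: "mpoly_eval w (E s) = mpoly_eval (\<lambda>j. a w j + s * z w j) (q (n + m))" for s w
    unfolding E_def mpoly_eval_sym_map
  proof (rule mpoly_eval_cong[OF sym_infD[OF q]])
    fix j assume "j < n + m"
    then show "(\<Sum>i<dim_row (M s). w i * M s $$ (i, j)) = a w j + s * z w j"
      by (simp add: block_sum[symmetric] M_def)
  qed
  have E_0: "E 0 = sym_map A (q m)"
    unfolding mpoly_eq_iff_eval[OF inf]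
  proof
    fix w
    have "mpoly_eval w (E 0) = mpoly_eval (a w) (q (n + m))" by (simp add: E_ev)
    also have "\<dots> = mpoly_eval (\<lambda>j. \<Sum>i<n. w i * A $$ (i, j)) (q m)"
      unfolding a_def by (rule mpoly_eval_sym_inf[OF inf q]) simp
    finally show "mpoly_eval w (E 0) = mpoly_eval w (sym_map A (q m))"
      using A by (simp add: mpoly_eval_sym_map)
  qed
  have "F (E s) = 0" if s: "s \<noteq> 0" for s
  proof -
    let ?g = "four_block_mat A (s \<cdot>\<^sub>m 1\<^sub>m n) (1\<^sub>m m) (0\<^sub>m m n)"
    have g: "?g \<in> carrier_mat (n + m) (n + m)" using A by auto
    have "gl_act ?g q n = E s"
      unfolding mpoly_eq_iff_eval[OF inf]
    proof
      fix w
      have "mpoly_eval w (gl_act ?g q n) = mpoly_eval (act_vec ?g n w) (q (n + m))"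
        using mpoly_eval_gl_act[OF q g, of w n] by (simp add: max_def)
      also have "\<dots> = mpoly_eval (\<lambda>j. a w j + s * z w j) (q (n + m))"
      proof (rule mpoly_eval_cong[OF sym_infD[OF q]])
        fix j assume j: "j < n + m"
        have "act_vec ?g n w j = (\<Sum>i<n + m. trunc n w i * ?g $$ (i, j))"
          using A j by (simp add: act_vec_def)
        \<comment> \<open>Truncation to \<open>n\<close> coordinates removes the contribution of the
          lower rows of \<open>?g\<close>.\<close>
        also have "\<dots> = (\<Sum>i<n. w i * (if j < m then A $$ (i, j) else if j = m + i then s else 0))"
          using A j by (intro sum.mono_neutral_cong_right) (auto simp: trunc_def)
        finally show "act_vec ?g n w j = a w j + s * z w j"
          using block_sum[OF j] by simp
      qed
      finally show "mpoly_eval w (gl_act ?g q n) = mpoly_eval w (E s)" by (simp add: E_ev)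
    qed
    then show ?thesis using vanish[OF block_in_GL[OF A s]] by simp
  qed
  moreover obtain P where P: "\<And>s. poly P s = F (E s)"
    using poly_funs_line[OF inf F sym_infD[OF q] E_in E_ev] by blast
  \<comment> \<open>The extra factor \<open>s\<close> covers the missing value \<open>s = 0\<close>;
    it is cancelled afterwards.\<close>
  ultimately have "poly (P * [:0, 1:]) s = poly 0 s" for s
    by (cases "s = 0") auto
  then have "P * [:0, 1:] = 0" by (rule poly_eq_infinite[OF inf])
  then have "P = 0" by simp
  then show ?thesis using P[of 0] E_0 by simp
qed

section \<open>Basic open sets of the inverse limit\<close>

lemma lookup_proj:
  fixes p :: "'a::field mpoly"
  assumes inf: "infinite (UNIV :: 'a set)" and p: "p \<in> sym_pow d n"
  shows "Poly_Mapping.lookup (sym_map (proj_mat n i) p) \<alpha> =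
    (if Poly_Mapping.keys \<alpha> \<subseteq> {..<i} then Poly_Mapping.lookup p \<alpha> else 0)"
proof -
  let ?K = "{m \<in> Poly_Mapping.keys p. Poly_Mapping.keys m \<subseteq> {..<i}}"
  define r where "r = (\<Sum>m\<in>?K. Poly_Mapping.single m (Poly_Mapping.lookup p m))"
  \<comment> \<open>A monomial with a variable of index at least \<open>i\<close> vanishes at
    truncated vectors, so projecting deletes exactly these monomials.\<close>
  have mon: "mon_eval (trunc i w) m = (if Poly_Mapping.keys m \<subseteq> {..<i} then mon_eval w m else 0)"
    for m and w :: "nat \<Rightarrow> 'a"
    unfolding mon_eval_def trunc_def
    by (auto simp: in_keys_iff intro!: prod.cong prod_zero)
  have "sym_map (proj_mat n i) p = r"
    unfolding mpoly_eq_iff_eval[OF inf]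
  proof
    fix w
    have "mpoly_eval w (sym_map (proj_mat n i) p) = (\<Sum>m\<in>?K. Poly_Mapping.lookup p m * mon_eval w m)"
      unfolding mpoly_eval_proj[OF p] unfolding mpoly_eval_def
      by (rule sum.mono_neutral_cong_right) (auto simp: mon)
    then show "mpoly_eval w (sym_map (proj_mat n i) p) = mpoly_eval w r"
      by (simp add: r_def)
  qed
  then have "Poly_Mapping.lookup (sym_map (proj_mat n i) p) \<alpha> =
      (\<Sum>m\<in>?K. if m = \<alpha> then Poly_Mapping.lookup p m else 0)"
    by (auto simp: r_def lookup_sum lookup_single when_def intro: sum.cong)
  then show ?thesis by (auto simp: in_keys_iff)
qed

text \<open>Lifts a polynomial condition at level \<open>i\<close> to level \<open>n\<close>: each
  coordinate pulls back to itself or to 0.\<close>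

lemma poly_funs_proj:
  assumes inf: "infinite (UNIV :: 'a::field set)" and "f \<in> poly_funs"
  shows "\<exists>h\<in>poly_funs. \<forall>p\<in>sym_pow d n. h p = f (sym_map (proj_mat n i) (p :: 'a mpoly))"
  using assms(2)
proof (induction rule: poly_funs.induct)
  case (const c)
  show ?case by (intro bexI[of _ "\<lambda>p. c"] poly_funs.const) auto
next
  case (coord \<alpha>)
  show ?case
  proof (cases "Poly_Mapping.keys \<alpha> \<subseteq> {..<i}")
    case True
    then show ?thesis
      by (intro bexI[of _ "\<lambda>p. Poly_Mapping.lookup p \<alpha>"] poly_funs.coord) (auto simp: lookup_proj[OF inf])
  next
    case False
    then show ?thesis
      by (intro bexI[of _ "\<lambda>p. 0"] poly_funs.const) (auto simp: lookup_proj[OF inf])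
  qed
next
  case (add f g)
  then obtain h k where "h \<in> poly_funs" "k \<in> poly_funs"
    "\<forall>p\<in>sym_pow d n. h p = f (sym_map (proj_mat n i) p)" "\<forall>p\<in>sym_pow d n. k p = g (sym_map (proj_mat n i) p)"
    by blast
  then show ?case by (intro bexI[of _ "\<lambda>p. h p + k p"] poly_funs.add) auto
next
  case (mult f g)
  then obtain h k where "h \<in> poly_funs" "k \<in> poly_funs"
    "\<forall>p\<in>sym_pow d n. h p = f (sym_map (proj_mat n i) p)" "\<forall>p\<in>sym_pow d n. k p = g (sym_map (proj_mat n i) p)"
    by blast
  then show ?case by (intro bexI[of _ "\<lambda>p. h p * k p"] poly_funs.mult) auto
qed

lemma poly_funs_prod: "(\<And>i. i \<in> J \<Longrightarrow> h i \<in> poly_funs) \<Longrightarrow> (\<lambda>p. \<Prod>i\<in>J. h i p) \<in> poly_funs"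
  by (induction J rule: infinite_finite_induct) (auto intro: poly_funs.const poly_funs.mult)

lemma proj_sym_inf:
  fixes x :: "nat \<Rightarrow> 'a::field mpoly"
  assumes inf: "infinite (UNIV :: 'a set)" and x: "x \<in> sym_inf d" and "i \<le> n"
  shows "sym_map (proj_mat n i) (x n) = x i"
  unfolding mpoly_eq_iff_eval[OF inf] mpoly_eval_proj[OF sym_infD[OF x]]
  using mpoly_eval_sym_inf[OF inf x \<open>i \<le> n\<close>] by blast

text \<open>A basic open set restricts only finitely many levels, and around \<open>x\<close> each
  restriction may be shrunk to the nonvanishing of one polynomial. These are pulled back to a common
  level, where their product is a single condition since \<open>K\<close> has no zero
  divisors.\<close>

lemma sym_inf_neighbourhood:
  fixes x :: "nat \<Rightarrow> 'a::field mpoly"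
  assumes inf: "infinite (UNIV :: 'a set)" and T: "openin (sym_inf_topology d) T" "x \<in> T"
  shows "\<exists>n h. h \<in> poly_funs \<and> h (x n) \<noteq> 0 \<and> (\<forall>y\<in>sym_inf d. h (y n) \<noteq> 0 \<longrightarrow> y \<in> T)"
proof -
  obtain V where V: "openin (product_topology (zariski d) UNIV) V" and T_eq: "T = V \<inter> sym_inf d"
    using T(1) unfolding sym_inf_topology_def openin_subtopology by blast
  have x: "x \<in> sym_inf d" "x \<in> V" using T(2) T_eq by auto
  obtain U where fin: "finite {i. U i \<noteq> topspace (zariski d i)}" and U: "\<And>i. openin (zariski d i) (U i)"
    and xU: "x \<in> Pi\<^sub>E UNIV U" and UV: "Pi\<^sub>E UNIV U \<subseteq> V"
    using V x(2) unfolding openin_product_topology_alt by fastforce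
  define J where "J = {i. U i \<noteq> topspace (zariski d i)}"
  \<comment> \<open>The inserted 0 keeps \<open>Max\<close> meaningful when no level is
    restricted.\<close>
  define n where "n = Max (insert 0 J)"
  have J: "finite J" using fin by (simp add: J_def)
  then have n: "i \<le> n" if "i \<in> J" for i using that by (simp add: n_def)
  have "\<exists>f\<in>poly_funs. f (x i) \<noteq> 0 \<and> (\<forall>p\<in>sym_pow d i. f p \<noteq> 0 \<longrightarrow> p \<in> U i)" for i
  proof -
    obtain F where F: "F \<subseteq> poly_funs" "U i = sym_pow d i - zero_locus d i F"
      using U[of i] unfolding openin_zariski by blast
    have "x i \<in> U i" using xU by auto
    then obtain f where "f \<in> F" "f (x i) \<noteq> 0" unfolding F(2) zero_locus_def by blast
    then show ?thesis using F unfolding zero_locus_def by blast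
  qed
  then obtain f where f: "\<And>i. f i \<in> poly_funs" "\<And>i. f i (x i) \<noteq> 0"
    "\<And>i p. p \<in> sym_pow d i \<Longrightarrow> f i p \<noteq> 0 \<Longrightarrow> p \<in> U i" by metis
  have "\<exists>h\<in>poly_funs. \<forall>p\<in>sym_pow d n. h p = f i (sym_map (proj_mat n i) p)" for i
    by (rule poly_funs_proj[OF inf f(1)])
  then obtain h where h: "\<And>i. h i \<in> poly_funs"
    "\<And>i p. p \<in> sym_pow d n \<Longrightarrow> h i p = f i (sym_map (proj_mat n i) p)" by metis
  have h_eq: "h i (y n) = f i (y i)" if "y \<in> sym_inf d" "i \<in> J" for y i
    using h(2)[OF sym_infD[OF that(1)]] proj_sym_inf[OF inf that(1) n[OF that(2)]] by simp
  show ?thesis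
  proof (intro exI[of _ n] exI[of _ "\<lambda>p. \<Prod>i\<in>J. h i p"] conjI ballI impI)
    show "(\<lambda>p. \<Prod>i\<in>J. h i p) \<in> poly_funs" by (intro poly_funs_prod h(1))
    show "(\<Prod>i\<in>J. h i (x n)) \<noteq> 0" using J f(2) h_eq[OF x(1)] by simp
    fix y assume y: "y \<in> sym_inf d" "(\<Prod>i\<in>J. h i (y n)) \<noteq> 0"
    have "y i \<in> U i" for i
    proof (cases "i \<in> J")
      case True
      then have "f i (y i) \<noteq> 0" using y(2) J h_eq[OF y(1)] by auto
      then show ?thesis using f(3) sym_infD[OF y(1)] by blast
    next
      case False
      then show ?thesis using sym_infD[OF y(1)] by (simp add: J_def)
    qed
    then show "y \<in> T" using UV y(1) T_eq by blast
  qed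
qed

theorem corollary8:
  fixes q :: "nat \<Rightarrow> 'a::field mpoly" and d :: nat
  assumes "d \<ge> 2"
    and "infinite (UNIV :: 'a set)"
    and "perfect_field TYPE('a)"
    and "CHAR('a) = 0 \<or> CHAR('a) > d"
    and "q \<in> sym_inf d"
    and "strength d q = \<infinity>"
  shows "sym_inf_topology d closure_of gl_orbit q = sym_inf d"
proof
  show "sym_inf_topology d closure_of gl_orbit q \<subseteq> sym_inf d"
    using closure_of_subset_topspace[of "sym_inf_topology d" "gl_orbit q"] by simp
  note inf = assms(2) and q = assms(5)
  show "sym_inf d \<subseteq> sym_inf_topology d closure_of gl_orbit q"
  proof
    fix x :: "nat \<Rightarrow> 'a mpoly" assume x: "x \<in> sym_inf d"
    have "\<exists>y\<in>gl_orbit q. y \<in> T" if T: "openin (sym_inf_topology d) T" "x \<in> T" for T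
    proof (rule ccontr)
      assume disjoint: "\<not> ?thesis"
      obtain n h where h: "h \<in> poly_funs" "h (x n) \<noteq> 0"
        and h_T: "\<forall>y\<in>sym_inf d. h (y n) \<noteq> 0 \<longrightarrow> y \<in> T"
        using sym_inf_neighbourhood[OF inf T] by (elim exE conjE) (rule that)
      \<comment> \<open>A translate with nonzero \<open>h\<close> would lie in \<open>T\<close>,
        which misses the orbit.\<close>
      have orbit: "h (gl_act g q n) = 0" if g: "g \<in> GL r" for g r
      proof (rule ccontr)
        assume "h (gl_act g q n) \<noteq> 0"
        moreover have "gl_act g q \<in> sym_inf d"
          using gl_act_in_sym_inf[OF inf q] g by (auto simp: GL_def)
        ultimately have "gl_act g q \<in> T" using h_T by blast
        moreover have "gl_act g q \<in> gl_orbit q" using g unfolding gl_orbit_def by blast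
        ultimately show False using disjoint by blast
      qed
      have "h (sym_map A (q m)) = 0" if "A \<in> carrier_mat n m" for A m
        by (rule vanish_on_matrices_if_vanish_on_orbit[OF inf q h(1) orbit that])
      \<comment> \<open>The equation \<open>h\<close> is not trivial on \<open>sym_pow d n\<close>:
        it is nonzero at \<open>x n\<close>.\<close>
      then have "finite_strength d q"
        using assms(1) by (intro finite_strength_if_equation[OF inf assms(3,4) _ q h(1) sym_infD[OF x] h(2)]) simp_all
      then show False using assms(6) by (simp add: strength_eq_infinity_iff)
    qed
    then show "x \<in> sym_inf_topology d closure_of gl_orbit q"
      using x by (auto simp: in_closure_of)
  qed
qed

end
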